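(* Let $\varphi$ be a gauge, let $(X,\|\cdot\|_X)$ be a real Banach space that is strictly convex, Fr\'echet differentiable, reflexive, and has the Radon--Riesz--Shmul'yan property, and let $\varnothing\ne K\subseteq X$. Then: (i) if $K$ is convex and closed, then the left projection $\overleftarrow{P}_K$ (with respect to $D_{\Psi_\varphi}$) is norm-to-norm continuous on $X$, and $x\mapsto\inf_{y\in K}D_{\Psi_\varphi}(y,x)$ is continuous on $X$; (ii) if $j_\varphi(K)$ is convex and closed, then the right projection $\overrightarrow{P}_K$ (with respect to $D_{\Psi_\varphi}$) is norm-to-norm continuous on $X$.
   Context: A gauge is a strictly increasing continuous $\varphi:[0,\infty[\to[0,\infty[$ with $\varphi(0)=0$, $\lim_{t\to\infty}\varphi(t)=\infty$. $\Psi_\varphi(x)=\int_0^{\|x\|}\varphi(t)\,dt$ on $X$. $(X,\|\cdot\|)$ is Fr\'echet differentiable iff its norm is Fr\'echet differentiable at every $x\neq0$. Radon--Riesz--Shmul'yan property: if $x_n\to x$ weakly and $\|x_n\|\to\|x\|$, then $\|x_n-x\|\to0$. The duality map $j_\varphi(x)=\{y\in X^*:\langle x,y\rangle=\|x\|\|y\|,\ \|y\|=\varphi(\|x\|)\}$ is here single-valued and equals the derivative $D\Psi_\varphi$; $\langle\cdot,\cdot\rangle$ is the pairing of $X\times X^*$. $D_{\Psi_\varphi}(x,y)=\Psi_\varphi(x)-\Psi_\varphi(y)-\langle x-y,j_\varphi(y)\rangle$. $\overleftarrow{P}_K(y)$ is the unique minimiser of $x\mapsto D_{\Psi_\varphi}(x,y)$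 over $K$; $\overrightarrow{P}_K(y)$ is the unique minimiser of $x\mapsto D_{\Psi_\varphi}(y,x)$ over $K$ (under the respective hypotheses these exist uniquely). *)

theory Defs
  imports "HOL-Analysis.Analysis"
begin

text \<open>
  The dual of \<^typ>\<open>'a\<close> is the type \<open>'a \<Rightarrow>\<^sub>L real\<close> of bounded linear functionals, and the
  pairing \<open>\<langle>x, y\<rangle>\<close> is \<^term>\<open>blinfun_apply y x\<close>.
\<close>

text \<open>Only the values on \<^term>\<open>{0::real..}\<close> matter. The name \<^const>\<open>gauge\<close> already denotes the
  gauges of Henstock--Kurzweil integration.\<close>

definition gauge_function :: "(real \<Rightarrow> real) \<Rightarrow> bool" where
  "gauge_function \<phi> \<longleftrightarrow>
     \<phi> ` {0..} \<subseteq> {0..} \<and> strict_mono_on {0..} \<phi> \<and> continuous_on {0..} \<phi> \<and>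
     \<phi> 0 = 0 \<and> filterlim \<phi> at_top at_top"

text \<open>The following properties of a space concern a whole type, passed as \<open>TYPE('a)\<close>.\<close>

definition strictly_convex_space :: "'a::real_normed_vector itself \<Rightarrow> bool" where
  "strictly_convex_space _ \<longleftrightarrow>
     (\<forall>x y :: 'a. norm x = 1 \<and> norm y = 1 \<and> x \<noteq> y \<longrightarrow> norm ((1/2) *\<^sub>R (x + y)) < 1)"

definition frechet_differentiable_space :: "'a::real_normed_vector itself \<Rightarrow> bool" where
  "frechet_differentiable_space _ \<longleftrightarrow>
     (\<forall>x :: 'a. x \<noteq> 0 \<longrightarrow> (norm :: 'a \<Rightarrow> real) differentiable (at x))"

text \<open>The canonical embedding into the bidual is onto.\<close>

definition reflexive_space :: "'a::real_normed_vector itself \<Rightarrow> bool" where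
  "reflexive_space _ \<longleftrightarrow>
     (\<forall>F :: ('a \<Rightarrow>\<^sub>L real) \<Rightarrow>\<^sub>L real. \<exists>x :: 'a. \<forall>f. blinfun_apply F f = blinfun_apply f x)"

definition weakly_tendsto :: "(nat \<Rightarrow> 'a::real_normed_vector) \<Rightarrow> 'a \<Rightarrow> bool" where
  "weakly_tendsto u x \<longleftrightarrow>
     (\<forall>f :: 'a \<Rightarrow>\<^sub>L real. (\<lambda>n. blinfun_apply f (u n)) \<longlonglongrightarrow> blinfun_apply f x)"

definition radon_riesz_space :: "'a::real_normed_vector itself \<Rightarrow> bool" where
  "radon_riesz_space _ \<longleftrightarrow>
     (\<forall>(u :: nat \<Rightarrow> 'a) x.
        weakly_tendsto u x \<and> (\<lambda>n. norm (u n)) \<longlonglongrightarrow> norm x \<longrightarrow> (\<lambda>n. norm (u n - x)) \<longlonglongrightarrow> 0)"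

definition Psi :: "(real \<Rightarrow> real) \<Rightarrow> 'a::real_normed_vector \<Rightarrow> real" where
  "Psi \<phi> x = integral {0..norm x} \<phi>"

definition duality_set ::
    "(real \<Rightarrow> real) \<Rightarrow> 'a::real_normed_vector \<Rightarrow> ('a \<Rightarrow>\<^sub>L real) set" where
  "duality_set \<phi> x = {y. blinfun_apply y x = norm x * norm y \<and> norm y = \<phi> (norm x)}"

text \<open>When \<^term>\<open>\<phi>\<close> is a gauge and the norm is Frechet differentiable away from 0,
  \<^const>\<open>duality_set\<close> is single-valued; this is its unique element.\<close>

definition duality_map ::
    "(real \<Rightarrow> real) \<Rightarrow> 'a::real_normed_vector \<Rightarrow> ('a \<Rightarrow>\<^sub>L real)" where
  "duality_map \<phi> x = (THE y. y \<in> duality_set \<phi> x)"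

definition bregman_Psi :: "(real \<Rightarrow> real) \<Rightarrow> 'a::real_normed_vector \<Rightarrow> 'a \<Rightarrow> real" where
  "bregman_Psi \<phi> x y = Psi \<phi> x - Psi \<phi> y - blinfun_apply (duality_map \<phi> y) (x - y)"

text \<open>The projections minimise over the first, respectively second, argument. They are
  meaningful where the minimiser exists and is unique.\<close>

definition left_projection ::
    "(real \<Rightarrow> real) \<Rightarrow> 'a::real_normed_vector set \<Rightarrow> 'a \<Rightarrow> 'a" where
  "left_projection \<phi> K y =
     (THE x. x \<in> K \<and> (\<forall>z\<in>K. bregman_Psi \<phi> x y \<le> bregman_Psi \<phi> z y))"

definition right_projection ::
    "(real \<Rightarrow> real) \<Rightarrow> 'a::real_normed_vector set \<Rightarrow> 'a \<Rightarrow> 'a" where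
  "right_projection \<phi> K y =
     (THE x. x \<in> K \<and> (\<forall>z\<in>K. bregman_Psi \<phi> y x \<le> bregman_Psi \<phi> y z))"

end

theory Submission
  imports Defs
begin

text \<open>
  The left projection of \<open>y\<close> minimises \<open>\<Psi> - j y\<close> over \<open>K\<close>. If \<open>x\<close> is the minimiser
  of \<open>\<Psi> - f\<close>, the variational inequality \<open>\<langle>z - x, j x - f\<rangle> \<ge> 0\<close> on \<open>K\<close> shows that the
  excess of \<open>\<Psi> - f\<close> at \<open>z \<in> K\<close> is at least \<open>D(z, x)\<close>, and
  \<open>D(x\<^sub>n, x) \<longlonglongrightarrow> 0\<close> forces \<open>x\<^sub>n \<longlonglongrightarrow> x\<close>: weak convergence comes from
  reflexivity and strict convexity, norm convergence then from the Radon--Riesz property. Hence the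
  minimiser depends continuously on \<open>f\<close>, and \<open>j\<close> is continuous by Shmul'yan's argument.

  With \<open>K = X\<close> this makes \<open>j\<close> a homeomorphism of \<open>X\<close> onto its dual. The dual inherits all the
  hypotheses, with the gauge \<open>\<phi>\<^sup>-\<^sup>1\<close>, and Young's equality gives
  \<open>D\<^sub>\<phi>(y, x) = D\<^sub>\<psi>(j x, j y)\<close> for \<open>\<psi> = \<phi>\<^sup>-\<^sup>1\<close>. So the right projection onto \<open>K\<close> is
  the left projection onto \<open>j K\<close> in the dual, conjugated by \<open>j\<close>.
\<close>

section \<open>Hahn--Banach and weak cluster points\<close>

definition sublinear :: "('a::real_vector \<Rightarrow> real) \<Rightarrow> bool" where
  "sublinear p \<longleftrightarrow>
     (\<forall>x y. p (x + y) \<le> p x + p y) \<and> (\<forall>t>0. \<forall>x. p (t *\<^sub>R x) \<le> t * p x)"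

lemma sublinear_add: "sublinear p \<Longrightarrow> p (x + y) \<le> p x + p y"
  by (simp add: sublinear_def)

lemma sublinear_scaleR_le: "sublinear p \<Longrightarrow> t > 0 \<Longrightarrow> p (t *\<^sub>R x) \<le> t * p x"
  by (simp add: sublinear_def)

lemma sublinear_zero: "sublinear p \<Longrightarrow> p 0 = 0"
  using sublinear_scaleR_le[of p 2 0] sublinear_scaleR_le[of p "1/2" 0] by simp

text \<open>The defining inequality, applied with factor \<open>1/t\<close> to
  \<open>t *\<^sub>R x\<close>, is the reverse inequality.\<close>

lemma sublinear_scaleR:
  assumes "sublinear p" "t \<ge> 0"
  shows "p (t *\<^sub>R x) = t * p x"
proof (cases "t = 0")
  case False
  then have "t > 0" using assms by simp
  have "p ((1/t) *\<^sub>R (t *\<^sub>R x)) \<le> (1/t) * p (t *\<^sub>R x)"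
    using \<open>t > 0\<close> by (intro sublinear_scaleR_le[OF assms(1)]) simp
  then have "t * p x \<le> p (t *\<^sub>R x)"
    using \<open>t > 0\<close> by (simp add: field_simps)
  then show ?thesis
    using sublinear_scaleR_le[OF assms(1) \<open>t > 0\<close>, of x] by simp
qed (simp add: sublinear_zero[OF assms(1)])

text \<open>\<open>S\<close> plays the role of the epigraph of a sublinear function.\<close>

definition bound_cone :: "('a::real_vector \<Rightarrow> real \<Rightarrow> bool) \<Rightarrow> bool" where
  "bound_cone S \<longleftrightarrow>
     (\<forall>x y a b. S x a \<longrightarrow> S y b \<longrightarrow> S (x + y) (a + b)) \<and>
     (\<forall>t>0. \<forall>x a. S x a \<longrightarrow> S (t *\<^sub>R x) (t * a)) \<and>
     (\<forall>x. \<exists>a. S x a) \<and> (\<forall>a. S 0 a \<longrightarrow> 0 \<le> a)"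

lemma bound_coneD:
  assumes "bound_cone S"
  shows "S x a \<Longrightarrow> S y b \<Longrightarrow> S (x + y) (a + b)"
    and "t > 0 \<Longrightarrow> S x a \<Longrightarrow> S (t *\<^sub>R x) (t * a)"
    and "\<exists>a. S x a"
    and "S 0 a \<Longrightarrow> 0 \<le> a"
  using assms unfolding bound_cone_def by blast+

lemma bound_coneI:
  assumes "\<And>x y a b. S x a \<Longrightarrow> S y b \<Longrightarrow> S (x + y) (a + b)"
    and "\<And>t x a. t > 0 \<Longrightarrow> S x a \<Longrightarrow> S (t *\<^sub>R x) (t * a)"
    and "\<And>x. \<exists>a. S x a"
    and "\<And>a. S 0 a \<Longrightarrow> 0 \<le> a"
  shows "bound_cone S"
  using assms unfolding bound_cone_def by blast

text \<open>The fibre of \<open>S\<close> over \<open>x\<close> is bounded below: adding a bound for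
  \<open>- x\<close> lands in the fibre over 0, whose members are nonnegative. The closure
  properties of \<open>S\<close> then pass to the infimum.\<close>

lemma bound_cone_Inf:
  assumes S: "bound_cone S"
  shows "sublinear (\<lambda>x. Inf {a. S x a})"
    and "S x a \<Longrightarrow> Inf {a. S x a} \<le> a"
proof -
  have bdd: "bdd_below {a. S x a}" for x
  proof -
    obtain b where b: "S (- x) b" using bound_coneD(3)[OF S] by blast
    have "- b \<le> a" if "S x a" for a
      using bound_coneD(4)[OF S, of "a + b"] bound_coneD(1)[OF S that b] by simp
    then show ?thesis by (auto simp: bdd_below_def)
  qed
  have le: "Inf {a. S x a} \<le> a" if "S x a" for x a
    by (rule cInf_lower[OF _ bdd]) (simp add: that)
  have ne: "{a. S x a} \<noteq> {}" for x
    using bound_coneD(3)[OF S, of x] by auto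
  have "Inf {a. S (x + y) a} \<le> Inf {a. S x a} + Inf {a. S y a}" for x y
  proof -
    have "Inf {a. S (x + y) a} - b \<le> Inf {a. S x a}" if "S y b" for b
    proof (rule cInf_greatest[OF ne])
      fix a assume "a \<in> {a. S x a}"
      then show "Inf {a. S (x + y) a} - b \<le> a"
        using le[OF bound_coneD(1)[OF S _ that], of x a] by simp
    qed
    then have "Inf {a. S (x + y) a} - Inf {a. S x a} \<le> Inf {a. S y a}"
      by (intro cInf_greatest[OF ne]) (auto simp: algebra_simps)
    then show ?thesis by simp
  qed
  moreover have "Inf {a. S (t *\<^sub>R x) a} \<le> t * Inf {a. S x a}" if "t > 0" for t x
  proof -
    have "Inf {a. S (t *\<^sub>R x) a} / t \<le> Inf {a. S x a}"
    proof (rule cInf_greatest[OF ne])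
      fix a assume "a \<in> {a. S x a}"
      then show "Inf {a. S (t *\<^sub>R x) a} / t \<le> a"
        using le[OF bound_coneD(2)[OF S that], of x a] that by (simp add: field_simps)
    qed
    then show ?thesis using that by (simp add: field_simps)
  qed
  ultimately show "sublinear (\<lambda>x. Inf {a. S x a})"
    by (simp add: sublinear_def)
  show "S x a \<Longrightarrow> Inf {a. S x a} \<le> a" by (rule le)
qed

text \<open>The lower boundary of this cone is the standard competitor of a minimal
  \<open>q\<close>: it lies below \<open>q\<close>, and if it equals \<open>q\<close> then
  \<open>q\<close> is additive in direction \<open>y\<close>.\<close>

lemma bound_cone_shift:
  assumes q: "sublinear q"
  shows "bound_cone (\<lambda>x a. \<exists>t\<ge>0. q (x + t *\<^sub>R y) - t * q y \<le> a)" (is "bound_cone ?S")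
proof (rule bound_coneI)
  fix x z a b assume "?S x a" "?S z b"
  then obtain s t where st: "s \<ge> 0" "q (x + s *\<^sub>R y) - s * q y \<le> a"
    "t \<ge> 0" "q (z + t *\<^sub>R y) - t * q y \<le> b" by blast
  have "q ((x + z) + (s + t) *\<^sub>R y) \<le> q (x + s *\<^sub>R y) + q (z + t *\<^sub>R y)"
    using sublinear_add[OF q, of "x + s *\<^sub>R y" "z + t *\<^sub>R y"] by (simp add: algebra_simps)
  then have "q ((x + z) + (s + t) *\<^sub>R y) - (s + t) * q y \<le> a + b"
    using st by (simp add: algebra_simps)
  then show "?S (x + z) (a + b)" using st by (intro exI[of _ "s + t"]) simp
next
  fix t :: real and x a assume "t > 0" "?S x a"
  then obtain s where s: "s \<ge> 0" "q (x + s *\<^sub>R y) - s * q y \<le> a" by blast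
  have "q (t *\<^sub>R (x + s *\<^sub>R y)) - (t * s) * q y \<le> t * a"
    using mult_left_mono[OF s(2), of t] \<open>t > 0\<close> sublinear_scaleR[OF q, of t "x + s *\<^sub>R y"]
    by (simp add: algebra_simps)
  then show "?S (t *\<^sub>R x) (t * a)"
    using s \<open>t > 0\<close> by (intro exI[of _ "t * s"]) (simp add: algebra_simps)
next
  fix x show "\<exists>a. ?S x a" by (intro exI[of _ "q x"] exI[of _ 0]) simp
next
  fix a assume "?S 0 a"
  then show "0 \<le> a" using sublinear_scaleR[OF q] by auto
qed

text \<open>In the shifted cone, \<open>t = 0\<close> puts the competitor below \<open>q\<close>, so
  minimality makes them equal; \<open>t = 1\<close> then gives
  \<open>q x + q y \<le> q (x + y)\<close>.\<close>

lemma sublinear_minimal_imp_linear: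
  assumes q: "sublinear q" and min: "\<And>r. sublinear r \<Longrightarrow> r \<le> q \<Longrightarrow> r = q"
  shows "linear q"
proof -
  have add: "q (x + y) = q x + q y" for x y
  proof -
    define S where "S = (\<lambda>x a. \<exists>t\<ge>0. q (x + t *\<^sub>R y) - t * q y \<le> a)"
    have S: "bound_cone S" unfolding S_def by (rule bound_cone_shift[OF q])
    have "S x (q x)" for x unfolding S_def by (intro exI[of _ 0]) simp
    then have "(\<lambda>x. Inf {a. S x a}) \<le> q"
      using bound_cone_Inf(2)[OF S] by (auto simp: le_fun_def)
    then have "(\<lambda>x. Inf {a. S x a}) = q"
      by (rule min[OF bound_cone_Inf(1)[OF S]])
    moreover have "S x (q (x + y) - q y)"
      unfolding S_def by (intro exI[of _ 1]) simp
    ultimately have "q x \<le> q (x + y) - q y"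
      using bound_cone_Inf(2)[OF S] by metis
    then show ?thesis using sublinear_add[OF q, of x y] by simp
  qed
  have neg: "q (- x) = - q x" for x
    using add[of x "- x"] sublinear_zero[OF q] by simp
  have "q (t *\<^sub>R x) = t * q x" for t x
  proof (cases "t \<ge> 0")
    case False
    then show ?thesis
      using sublinear_scaleR[OF q, of "- t" x] neg[of "t *\<^sub>R x"] by simp
  qed (simp add: sublinear_scaleR[OF q])
  then show ?thesis using add by (intro linearI) auto
qed

text \<open>Zorn's lemma yields a minimal sublinear function below the lower boundary of
  \<open>S\<close>, and minimality makes it linear. Stated for cones, the result can be applied by
  checking closure properties of explicit bounds.\<close>

theorem hahn_banach_cone:
  assumes S: "bound_cone S"
  obtains F where "linear F" "\<And>x a. S x a \<Longrightarrow> F x \<le> a"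
proof -
  define p where "p = (\<lambda>x. Inf {a. S x a})"
  have p: "sublinear p" unfolding p_def by (rule bound_cone_Inf(1)[OF S])
  define A where "A = {q. sublinear q \<and> q \<le> p}"
  have "\<exists>m\<in>A. \<forall>a\<in>A. m \<ge> a \<longrightarrow> a = m"
  proof (rule predicate_Zorn)
    show "partial_order_on A (relation_of (\<lambda>x y. x \<ge> y) A)"
      by (rule partial_order_on_relation_ofI) auto
    fix C assume "C \<in> Chains (relation_of (\<lambda>x y. x \<ge> y) A)"
    then have CA: "C \<subseteq> A" and tot: "\<And>q r. q \<in> C \<Longrightarrow> r \<in> C \<Longrightarrow> q \<le> r \<or> r \<le> q"
      unfolding Chains_def relation_of_def by auto
    show "\<exists>u\<in>A. \<forall>a\<in>C. a \<ge> u"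
    proof (cases "C = {}")
      case True
      then show ?thesis using p by (auto simp: A_def)
    next
      case False
      then obtain q0 where q0: "q0 \<in> C" by blast
      \<comment> \<open>The union of the epigraphs of the chain; its lower boundary \<open>u\<close>
        is a lower bound of the chain.\<close>
      define T where "T = (\<lambda>x a. \<exists>q\<in>C. q x \<le> a)"
      have sub: "sublinear q" if "q \<in> C" for q using that CA by (auto simp: A_def)
      have T: "bound_cone T"
      proof (rule bound_coneI)
        fix x y a b assume "T x a" "T y b"
        then obtain q r where qr: "q \<in> C" "r \<in> C" "q x \<le> a" "r y \<le> b"
          by (auto simp: T_def)
        \<comment> \<open>Of two comparable functions the smaller one satisfies both bounds.\<close>
        define s where "s = (if q \<le> r then q else r)"
        have "s \<in> C" "s \<le> q" "s \<le> r" using tot[OF qr(1,2)] qr by (auto simp: s_def)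
        then have "s x \<le> a" "s y \<le> b" using qr(3,4) by (meson le_fun_def order_trans)+
        then have "s (x + y) \<le> a + b"
          using sublinear_add[OF sub[OF \<open>s \<in> C\<close>], of x y] by simp
        then show "T (x + y) (a + b)" using \<open>s \<in> C\<close> by (auto simp: T_def)
      next
        fix t :: real and x a assume "t > 0" "T x a"
        then obtain q where "q \<in> C" "q x \<le> a" by (auto simp: T_def)
        then show "T (t *\<^sub>R x) (t * a)"
          using sublinear_scaleR[OF sub, of q t x] \<open>t > 0\<close> by (auto simp: T_def intro!: bexI[of _ q])
      next
        fix x show "\<exists>a. T x a" using q0 by (auto simp: T_def)
      next
        fix a assume "T 0 a" then show "0 \<le> a" using sublinear_zero[OF sub] unfolding T_def by metis
      qed
      define u where "u = (\<lambda>x. Inf {a. T x a})"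
      have "u \<le> q" if "q \<in> C" for q
        using bound_cone_Inf(2)[OF T] that unfolding u_def le_fun_def T_def by blast
      moreover have "u \<in> A"
        using bound_cone_Inf(1)[OF T] calculation[OF q0] q0 CA
        by (auto simp: A_def u_def[symmetric])
      ultimately show ?thesis by auto
    qed
  qed
  then obtain m where m: "sublinear m" "m \<le> p" and
    min: "\<And>a. sublinear a \<Longrightarrow> a \<le> p \<Longrightarrow> a \<le> m \<Longrightarrow> a = m"
    by (auto simp: A_def)
  have "linear m"
    by (rule sublinear_minimal_imp_linear[OF m(1)]) (meson min m(2) order_trans)
  moreover have "m x \<le> a" if "S x a" for x a
    using bound_cone_Inf(2)[OF S that] m(2) unfolding p_def le_fun_def by (meson order_trans)
  ultimately show ?thesis using that by blast
qed

text \<open>With \<open>d\<close> the distance from \<open>x\<close> to \<open>K\<close>, a linear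
  \<open>F\<close> below the norm with \<open>F (x - k) \<le> - d\<close> on \<open>K\<close>
  separates after a change of sign. The cone \<open>S\<close> encodes both requirements.\<close>

lemma closed_convex_separation:
  fixes K :: "'a::real_normed_vector set"
  assumes "convex K" "closed K" "x \<notin> K"
  obtains g :: "'a \<Rightarrow>\<^sub>L real" and c where "g x > c" "\<And>k. k \<in> K \<Longrightarrow> g k \<le> c"
proof (cases "K = {}")
  case True
  then show ?thesis using that[of "- 1" 0] by simp
next
  case False
  define d where "d = infdist x K"
  have d: "d > 0"
    unfolding d_def using False assms(2,3) in_closed_iff_infdist_zero infdist_nonneg
    by (metis less_eq_real_def)
  have dK: "d \<le> norm (k - x)" if "k \<in> K" for k
    using infdist_le[OF that, of x] by (simp add: d_def dist_norm norm_minus_commute)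
  define S where "S = (\<lambda>z a. \<exists>t\<ge>0. \<exists>k\<in>K. norm (z + t *\<^sub>R (k - x)) - t * d \<le> a)"
  have "bound_cone S"
  proof (rule bound_coneI)
    fix y z a b assume "S y a" "S z b"
    then obtain s t k l where *: "s \<ge> 0" "t \<ge> 0" "k \<in> K" "l \<in> K"
      "norm (y + s *\<^sub>R (k - x)) - s * d \<le> a" "norm (z + t *\<^sub>R (l - x)) - t * d \<le> b"
      unfolding S_def by blast
    \<comment> \<open>Convexity merges \<open>k\<close> and \<open>l\<close> into their average with
      weights proportional to \<open>s\<close> and \<open>t\<close>; if both weights vanish, any
      point of \<open>K\<close> serves.\<close>
    obtain m where m: "m \<in> K" "(s + t) *\<^sub>R (m - x) = s *\<^sub>R (k - x) + t *\<^sub>R (l - x)"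
    proof (cases "s + t = 0")
      case True
      then have "s = 0" "t = 0" using * by auto
      then show ?thesis using that[of k] * by simp
    next
      case False
      then have "s + t > 0" using * by simp
      define m where "m = (s / (s + t)) *\<^sub>R k + (t / (s + t)) *\<^sub>R l"
      have "m \<in> K"
        unfolding m_def using assms(1) * \<open>s + t > 0\<close>
        by (intro convexD) (auto simp: add_divide_distrib[symmetric])
      moreover have "(s + t) *\<^sub>R m = s *\<^sub>R k + t *\<^sub>R l"
        using False unfolding m_def by (simp only: scaleR_add_right scaleR_scaleR) simp
      ultimately show ?thesis
        using that[of m] by (simp add: scaleR_diff_right scaleR_add_left)
    qed
    have "norm ((y + z) + (s + t) *\<^sub>R (m - x)) \<le>
        norm (y + s *\<^sub>R (k - x)) + norm (z + t *\<^sub>R (l - x))"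
      unfolding m(2)
      using norm_triangle_ineq[of "y + s *\<^sub>R (k - x)" "z + t *\<^sub>R (l - x)"]
      by (simp add: algebra_simps)
    then have "norm ((y + z) + (s + t) *\<^sub>R (m - x)) - (s + t) * d \<le> a + b"
      using * by (simp add: algebra_simps)
    then show "S (y + z) (a + b)"
      unfolding S_def using * m by (intro exI[of _ "s + t"] conjI bexI[of _ m]) auto
  next
    fix t :: real and z a assume "t > 0" "S z a"
    then obtain s k where *: "s \<ge> 0" "k \<in> K" "norm (z + s *\<^sub>R (k - x)) - s * d \<le> a"
      unfolding S_def by blast
    have "norm (t *\<^sub>R z + (t * s) *\<^sub>R (k - x)) = t * norm (z + s *\<^sub>R (k - x))"
      using norm_scaleR[of t "z + s *\<^sub>R (k - x)"] \<open>t > 0\<close> by (simp add: scaleR_add_right)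
    then have "norm (t *\<^sub>R z + (t * s) *\<^sub>R (k - x)) - (t * s) * d \<le> t * a"
      using mult_left_mono[OF *(3), of t] \<open>t > 0\<close> by (simp add: right_diff_distrib)
    then show "S (t *\<^sub>R z) (t * a)"
      unfolding S_def using * \<open>t > 0\<close> by (intro exI[of _ "t * s"]) auto
  next
    fix z show "\<exists>a. S z a"
      unfolding S_def using False
      by (intro exI[of _ "norm z"] exI[of _ 0]) auto
  next
    fix a assume "S 0 a"
    then obtain t k where "t \<ge> 0" "k \<in> K" "t * norm (k - x) - t * d \<le> a"
      unfolding S_def by auto
    moreover have "t * d \<le> t * norm (k - x)"
      using dK \<open>k \<in> K\<close> \<open>t \<ge> 0\<close> by (intro mult_left_mono) auto
    ultimately show "0 \<le> a" by simp
  qed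
  then obtain F where F: "linear F" "\<And>z a. S z a \<Longrightarrow> F z \<le> a"
    using hahn_banach_cone by blast
  have le: "F z \<le> norm z" for z
    using False by (intro F(2)) (auto simp: S_def intro!: exI[of _ 0])
  have "norm (F z) \<le> norm z * 1" for z
    using le[of z] le[of "- z"] linear_neg[OF F(1), of z] by (simp add: abs_le_iff)
  then have bl: "bounded_linear F"
    using F(1) by (intro bounded_linear_intro[where K = 1])
      (auto simp: linear_add linear_scale)
  have "F x + d \<le> F k" if "k \<in> K" for k
  proof -
    \<comment> \<open>With \<open>t = 1\<close> and this \<open>k\<close> the vector inside the norm
      vanishes.\<close>
    have "F (x - k) \<le> - d"
      using that by (intro F(2)) (auto simp: S_def intro!: exI[of _ 1] bexI[of _ k])
    then show ?thesis using linear_diff[OF F(1), of x k] by simp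
  qed
  then show ?thesis
    using that[of "- F x - d" "- Blinfun F"] d
    by (simp add: bounded_linear_Blinfun_apply[OF bl] uminus_blinfun.rep_eq algebra_simps)
qed

text \<open>Linear functionals bounded by the \<open>limsup\<close> on the dual play the role of weak limits, so that
  no weak sequential compactness is needed.\<close>

lemma weak_cluster_point:
  fixes x :: "'i \<Rightarrow> 'a::real_normed_vector"
  assumes "reflexive_space TYPE('a)" "G \<noteq> bot" "\<forall>\<^sub>F n in G. norm (x n) \<le> B"
  obtains z where "\<And>(f :: 'a \<Rightarrow>\<^sub>L real) c. \<forall>\<^sub>F n in G. f (x n) \<le> c \<Longrightarrow> f z \<le> c"
proof -
  define S where "S = (\<lambda>(f :: 'a \<Rightarrow>\<^sub>L real) c. \<forall>\<^sub>F n in G. f (x n) \<le> c)"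
  have bound: "\<forall>\<^sub>F n in G. f (x n) \<le> norm f * B" for f :: "'a \<Rightarrow>\<^sub>L real"
    using assms(3)
  proof eventually_elim
    case (elim n)
    have "f (x n) \<le> norm f * norm (x n)" using norm_blinfun[of f "x n"] by simp
    also have "\<dots> \<le> norm f * B" using elim by (intro mult_left_mono) auto
    finally show ?case .
  qed
  have "bound_cone S"
  proof (rule bound_coneI)
    fix f g a b assume "S f a" "S g b"
    then show "S (f + g) (a + b)"
      unfolding S_def by eventually_elim (simp add: plus_blinfun.rep_eq)
  next
    fix t :: real and f a assume "t > 0" "S f a"
    from \<open>S f a\<close> show "S (t *\<^sub>R f) (t * a)"
      unfolding S_def by eventually_elim (simp add: scaleR_blinfun.rep_eq \<open>t > 0\<close>)
  next
    fix f show "\<exists>a. S f a" using bound[of f] by (auto simp: S_def)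
  next
    fix a assume "S 0 a" then show "0 \<le> a" using assms(2) by (simp add: S_def)
  qed
  then obtain F where F: "linear F" "\<And>f a. S f a \<Longrightarrow> F f \<le> a"
    using hahn_banach_cone by blast
  have le: "F f \<le> norm f * B" for f
    using F(2) bound by (auto simp: S_def)
  have "norm (F f) \<le> norm f * B" for f
    using le[of f] le[of "- f"] linear_neg[OF F(1), of f] by (simp add: abs_le_iff)
  then have "bounded_linear F"
    using F(1) by (intro bounded_linear_intro[where K = B]) (auto simp: linear_add linear_scale)
  \<comment> \<open>Reflexivity turns the bounded functional on the dual into a point of the
    space.\<close>
  then obtain z where "\<And>f. F f = blinfun_apply f z"
    using assms(1) unfolding reflexive_space_def by (metis bounded_linear_Blinfun_apply)
  then show ?thesis using that[of z] F(2) by (auto simp: S_def)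
qed

section \<open>Support functionals of a differentiable norm\<close>

lemma norm_gateaux_derivative:
  fixes x h :: "'a::real_normed_vector"
  assumes "(norm has_derivative u) (at x)"
  shows "((\<lambda>t. (norm (x + t *\<^sub>R h) - norm x) / t) \<longlongrightarrow> u h) (at_right 0)"
proof -
  have "((\<lambda>t. norm (x + t *\<^sub>R h)) has_derivative (\<lambda>t. u (t *\<^sub>R h))) (at 0)"
    by (rule has_derivative_compose[where g = norm and f = "\<lambda>t. x + t *\<^sub>R h"])
      (auto intro!: derivative_eq_intros assms)
  moreover have "(\<lambda>t. u (t *\<^sub>R h)) = (*) (u h)"
    using linear_scale[OF has_derivative_linear[OF assms], of _ h] by (auto simp: fun_eq_iff)
  ultimately have "((\<lambda>t. norm (x + t *\<^sub>R h)) has_field_derivative u h) (at 0)"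
    by (simp add: has_field_derivative_def)
  then show ?thesis
    by (auto simp: DERIV_def filterlim_at_split)
qed

text \<open>By homogeneity the difference quotient in direction \<open>x\<close> is constantly
  \<open>norm x\<close> for positive \<open>t\<close>; by the triangle inequality the quotient in
  direction \<open>h\<close> is at most \<open>norm h\<close>.\<close>

lemma norm_derivative_support:
  fixes x :: "'a::real_normed_vector"
  assumes "(norm has_derivative blinfun_apply u) (at x)" "x \<noteq> 0"
  shows "blinfun_apply u x = norm x" and "norm u = 1"
proof -
  have pos: "\<forall>\<^sub>F t in at_right 0. (0::real) < t"
    by (simp add: eventually_at_right_less)
  have "((\<lambda>t. (norm (x + t *\<^sub>R x) - norm x) / t) \<longlongrightarrow> norm x) (at_right 0)"
  proof (rule tendsto_eventually, use pos in eventually_elim)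
    fix t :: real assume "0 < t"
    have "norm (x + t *\<^sub>R x) = (1 + t) * norm x"
      using norm_scaleR[of "1 + t" x] \<open>0 < t\<close> by (simp add: algebra_simps)
    then show "(norm (x + t *\<^sub>R x) - norm x) / t = norm x"
      using \<open>0 < t\<close> by (simp add: field_simps)
  qed
  then show ux: "blinfun_apply u x = norm x"
    using norm_gateaux_derivative[OF assms(1)] by (intro tendsto_unique) auto
  have le: "blinfun_apply u h \<le> norm h" for h
  proof (rule tendsto_upperbound[OF norm_gateaux_derivative[OF assms(1)]])
    show "\<forall>\<^sub>F t in at_right 0. (norm (x + t *\<^sub>R h) - norm x) / t \<le> norm h"
      using pos
    proof eventually_elim
      case (elim t)
      then show ?case
        using norm_triangle_ineq[of x "t *\<^sub>R h"] by (simp add: field_simps)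
    qed
  qed simp
  have "norm u \<le> 1"
    using le le[of "- _"] by (intro norm_blinfun_bound) (auto simp: abs_le_iff blinfun.minus_right)
  moreover have "norm x \<le> norm u * norm x"
    using norm_blinfun[of u x] ux by simp
  ultimately show "norm u = 1" using assms(2) by (intro order_antisym) auto
qed

text \<open>On a small sphere of radius \<open>r\<close>,
  \<open>v n (x + h) \<le> norm (x + h)\<close>, and differentiability bounds the right side by
  \<open>norm x + u h + e' * r\<close>. Since \<open>v n x\<close> is eventually within
  \<open>e' * r\<close> of \<open>norm x\<close>, this gives
  \<open>(v n - u) h \<le> 2 * e' * r\<close> uniformly in \<open>h\<close>.\<close>

lemma smulian:
  fixes x :: "'a::real_normed_vector"
  assumes u: "(norm has_derivative blinfun_apply u) (at x)"
    and v: "\<forall>\<^sub>F n in G. norm (v n) \<le> 1" "((\<lambda>n. blinfun_apply (v n) x) \<longlongrightarrow> norm x) G"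
  shows "(v \<longlongrightarrow> u) G"
proof (rule tendstoI)
  fix e :: real assume "e > 0"
  define e' where "e' = e / 3"
  have e': "e' > 0" using \<open>e > 0\<close> by (simp add: e'_def)
  obtain d where d: "d > 0"
    "\<And>y. norm (y - x) < d \<Longrightarrow> \<bar>norm y - norm x - blinfun_apply u (y - x)\<bar> \<le> e' * norm (y - x)"
    using u e' unfolding has_derivative_at_alt by (metis real_norm_def)
  define r where "r = d / 2"
  have r: "r > 0" "r < d" using d by (auto simp: r_def)
  have "\<forall>\<^sub>F n in G. norm x - e' * r < blinfun_apply (v n) x"
    using v(2) e' r by (intro order_tendstoD(1)[OF v(2)]) simp
  with v(1) show "\<forall>\<^sub>F n in G. dist (v n) u < e"
  proof eventually_elim
    case (elim n)
    have unit: "blinfun_apply (v n - u) h \<le> 2 * e' * r" if "norm h = r" for h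
    proof -
      have "blinfun_apply (v n) (x + h) \<le> norm (v n) * norm (x + h)"
        using norm_blinfun[of "v n" "x + h"] by simp
      also have "\<dots> \<le> norm (x + h)"
        using elim(1) by (simp add: mult_left_le_one_le)
      also have "\<dots> \<le> norm x + blinfun_apply u h + e' * r"
        using d(2)[of "x + h"] that r by (simp add: abs_le_iff)
      finally show ?thesis
        using elim(2) by (simp add: blinfun.add_right minus_blinfun.rep_eq algebra_simps)
    qed
    have le: "blinfun_apply (v n - u) h \<le> 2 * e' * norm h" for h
    proof (cases "h = 0")
      case False
      have "blinfun_apply (v n - u) ((r / norm h) *\<^sub>R h) \<le> 2 * e' * r"
        by (rule unit) (use False r in simp)
      then have "(r / norm h) * blinfun_apply (v n - u) h \<le> 2 * e' * r"
        by (simp only: blinfun.scaleR_right real_scaleR_def)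
      then show ?thesis using r False by (simp add: field_simps)
    qed simp
    have "norm (v n - u) \<le> 2 * e'"
      using le le[of "- _"] e'
      by (intro norm_blinfun_bound) (auto simp: abs_le_iff blinfun.minus_right)
    then show ?case using \<open>e > 0\<close> by (simp add: dist_norm e'_def)
  qed
qed

text \<open>Shmul'yan's argument applied to a constant sequence.\<close>

lemma support_unique:
  fixes x :: "'a::real_normed_vector"
  assumes "(norm has_derivative blinfun_apply u) (at x)"
    and "norm v \<le> 1" "blinfun_apply v x = norm x"
  shows "v = u"
proof -
  have "((\<lambda>_. v) \<longlongrightarrow> u) sequentially"
    by (rule smulian[OF assms(1)]) (use assms(2,3) in auto)
  then show ?thesis by (simp add: LIMSEQ_const_iff)
qed

lemma frechet_support:
  fixes x :: "'a::real_normed_vector"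
  assumes "frechet_differentiable_space TYPE('a)" "x \<noteq> 0"
  obtains u where "(norm has_derivative blinfun_apply u) (at x)"
    "blinfun_apply u x = norm x" "norm u = 1"
proof -
  obtain D where "((norm :: 'a \<Rightarrow> real) has_derivative D) (at x)"
    using assms unfolding frechet_differentiable_space_def differentiable_def by blast
  then have "(norm has_derivative blinfun_apply (Blinfun D)) (at x)"
    using bounded_linear_Blinfun_apply has_derivative_bounded_linear by metis
  then show ?thesis using that norm_derivative_support[OF _ assms(2)] by blast
qed

section \<open>Gauges\<close>

context
  fixes \<phi> :: "real \<Rightarrow> real"
  assumes gauge: "gauge_function \<phi>"
begin

lemma gauge_nonneg: "0 \<le> t \<Longrightarrow> 0 \<le> \<phi> t"
  using gauge unfolding gauge_function_def by auto

lemma gauge_zero: "\<phi> 0 = 0"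
  using gauge unfolding gauge_function_def by auto

lemma gauge_less_iff: "0 \<le> s \<Longrightarrow> 0 \<le> t \<Longrightarrow> \<phi> s < \<phi> t \<longleftrightarrow> s < t"
  using gauge unfolding gauge_function_def by (auto simp: strict_mono_on_less)

lemma gauge_le_iff: "0 \<le> s \<Longrightarrow> 0 \<le> t \<Longrightarrow> \<phi> s \<le> \<phi> t \<longleftrightarrow> s \<le> t"
  using gauge_less_iff[of t s] by (simp add: not_less[symmetric])

lemma gauge_eq_iff: "0 \<le> s \<Longrightarrow> 0 \<le> t \<Longrightarrow> \<phi> s = \<phi> t \<longleftrightarrow> s = t"
  using gauge_le_iff[of s t] gauge_le_iff[of t s] by (simp add: order_eq_iff)

lemma gauge_continuous_on: "continuous_on {0..} \<phi>"
  using gauge unfolding gauge_function_def by auto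

lemma gauge_pos: "0 < t \<Longrightarrow> 0 < \<phi> t"
  using gauge_less_iff[of 0 t] by (simp add: gauge_zero)

lemma gauge_unbounded: "\<exists>t\<ge>0. c \<le> \<phi> t"
proof -
  have "filterlim \<phi> at_top at_top" using gauge unfolding gauge_function_def by auto
  then have "\<forall>\<^sub>F t in at_top. c \<le> \<phi> t \<and> 0 \<le> t"
    by (simp add: filterlim_at_top eventually_conj_iff)
  then show ?thesis
    unfolding eventually_at_top_linorder by blast
qed

lemma gauge_surj: "0 \<le> b \<Longrightarrow> \<exists>a\<ge>0. \<phi> a = b"
proof -
  assume "0 \<le> b"
  obtain t where "t \<ge> 0" "b \<le> \<phi> t" using gauge_unbounded by blast
  then show ?thesis
    using IVT'[of \<phi> 0 b t] continuous_on_subset[OF gauge_continuous_on, of "{0..t}"] \<open>0 \<le> b\<close>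
    by (auto simp: gauge_zero)
qed

text \<open>Subgradient inequality for the primitive of \<open>\<phi>\<close>: as
  \<open>\<phi>\<close> is increasing, the integrand lies on the right side of the constant
  \<open>\<phi> r\<close> in both orders of \<open>r\<close> and \<open>s\<close>.\<close>

lemma gauge_integral_diff_ge:
  assumes "0 \<le> r" "0 \<le> s"
  shows "\<phi> r * (s - r) \<le> integral {0..s} \<phi> - integral {0..r} \<phi>"
proof -
  have int: "\<phi> integrable_on {a..b}" if "0 \<le> a" for a b
    by (rule integrable_continuous_real, rule continuous_on_subset[OF gauge_continuous_on])
      (use that in auto)
  show ?thesis
  proof (cases "r \<le> s")
    case True
    have "integral {r..s} (\<lambda>_. \<phi> r) \<le> integral {r..s} \<phi>"
      using assms by (intro integral_le int) (auto simp: gauge_le_iff)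
    moreover have "integral {0..r} \<phi> + integral {r..s} \<phi> = integral {0..s} \<phi>"
      using assms True by (intro Henstock_Kurzweil_Integration.integral_combine int) auto
    ultimately show ?thesis using True by (simp add: algebra_simps)
  next
    case False
    have "integral {s..r} \<phi> \<le> integral {s..r} (\<lambda>_. \<phi> r)"
      using assms by (intro integral_le int) (auto simp: gauge_le_iff)
    moreover have "integral {0..s} \<phi> + integral {s..r} \<phi> = integral {0..r} \<phi>"
      using assms False by (intro Henstock_Kurzweil_Integration.integral_combine int) auto
    ultimately show ?thesis using False by (simp add: algebra_simps)
  qed
qed

text \<open>Adding the weak inequalities from \<open>r\<close> to the midpoint \<open>m\<close> and
  from \<open>m\<close> to \<open>s\<close> improves the slope on the second half from
  \<open>\<phi> r\<close> to \<open>\<phi> m\<close>.\<close>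

lemma gauge_integral_diff_greater:
  assumes "0 \<le> r" "0 \<le> s" "r \<noteq> s"
  shows "\<phi> r * (s - r) < integral {0..s} \<phi> - integral {0..r} \<phi>"
proof -
  define m where "m = (r + s) / 2"
  have m: "0 \<le> m" using assms by (simp add: m_def)
  have "(\<phi> m - \<phi> r) * (s - r) > 0"
  proof (cases "r < s")
    case True
    then show ?thesis
      using gauge_less_iff[OF assms(1) m] by (intro mult_pos_pos) (auto simp: m_def)
  next
    case False
    then show ?thesis
      using gauge_less_iff[OF m assms(1)] assms(3) by (intro mult_neg_neg) (auto simp: m_def)
  qed
  then have "\<phi> r * (s - r) < \<phi> m * (s - m) + \<phi> r * (m - r)"
    by (simp add: m_def field_simps)
  then show ?thesis
    using gauge_integral_diff_ge[OF assms(1) m] gauge_integral_diff_ge[OF m assms(2)] by simp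
qed

lemma gauge_integral_less_iff:
  assumes "0 \<le> r" "0 \<le> s"
  shows "integral {0..r} \<phi> < integral {0..s} \<phi> \<longleftrightarrow> r < s"
proof -
  have *: "integral {0..a} \<phi> < integral {0..b} \<phi>" if "0 \<le> a" "a < b" for a b
  proof -
    have "0 \<le> \<phi> a * (b - a)" using that gauge_nonneg[of a] by (intro mult_nonneg_nonneg) auto
    then show ?thesis using that gauge_integral_diff_greater[of a b] by simp
  qed
  show ?thesis using *[of r s] *[of s r] assms by (cases r s rule: linorder_cases) auto
qed

end

section \<open>The inverse gauge and Young's equality\<close>

definition inverse_gauge :: "(real \<Rightarrow> real) \<Rightarrow> real \<Rightarrow> real" where
  "inverse_gauge \<phi> = the_inv_into {0..} \<phi>"

context
  fixes \<phi> :: "real \<Rightarrow> real"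
  assumes gauge: "gauge_function \<phi>"
begin

lemma inverse_gauge_gauge: "0 \<le> t \<Longrightarrow> inverse_gauge \<phi> (\<phi> t) = t"
  unfolding inverse_gauge_def
  by (intro the_inv_into_f_f inj_onI) (auto simp: gauge_eq_iff[OF gauge])

lemma inverse_gauge_nonneg: "0 \<le> b \<Longrightarrow> 0 \<le> inverse_gauge \<phi> b"
  and gauge_inverse_gauge: "0 \<le> b \<Longrightarrow> \<phi> (inverse_gauge \<phi> b) = b"
  using gauge_surj[OF gauge, of b] inverse_gauge_gauge by auto

text \<open>These equivalences carry strict monotonicity, continuity and divergence over to the
  inverse.\<close>

lemma less_inverse_gauge_iff: "0 \<le> a \<Longrightarrow> 0 \<le> b \<Longrightarrow> a < inverse_gauge \<phi> b \<longleftrightarrow> \<phi> a < b"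
  and inverse_gauge_less_iff: "0 \<le> a \<Longrightarrow> 0 \<le> b \<Longrightarrow> inverse_gauge \<phi> b < a \<longleftrightarrow> b < \<phi> a"
  using gauge_less_iff[OF gauge, of a "inverse_gauge \<phi> b"]
    gauge_less_iff[OF gauge, of "inverse_gauge \<phi> b" a]
  by (simp_all add: inverse_gauge_nonneg gauge_inverse_gauge)

lemma gauge_function_inverse: "gauge_function (inverse_gauge \<phi>)"
  unfolding gauge_function_def
proof (intro conjI)
  show "inverse_gauge \<phi> ` {0..} \<subseteq> {0..}"
    by (auto simp: inverse_gauge_nonneg)
  show "strict_mono_on {0..} (inverse_gauge \<phi>)"
    by (rule strict_mono_onI)
      (simp add: less_inverse_gauge_iff inverse_gauge_nonneg gauge_inverse_gauge)
  show "inverse_gauge \<phi> 0 = 0"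
    using inverse_gauge_gauge[of 0] by (simp add: gauge_zero[OF gauge])
  show "continuous_on {0..} (inverse_gauge \<phi>)"
    unfolding continuous_on_def
  proof (intro ballI order_tendstoI)
    fix b a :: real assume b: "b \<in> {0..}"
    have id: "((\<lambda>y. y) \<longlongrightarrow> b) (at b within {0..})" by (rule tendsto_ident_at)
    have pos: "\<forall>\<^sub>F y in at b within {0..}. 0 \<le> y"
      by (simp add: eventually_at_filter)
    {
      assume a: "a < inverse_gauge \<phi> b"
      show "\<forall>\<^sub>F y in at b within {0..}. a < inverse_gauge \<phi> y"
      proof (cases "a < 0")
        case True
        from pos show ?thesis
        proof eventually_elim
          case (elim y)
          then show ?case using inverse_gauge_nonneg[of y] True by simp
        qed
      next
        case False
        then have "\<phi> a < b" using a b by (simp add: less_inverse_gauge_iff)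
        from order_tendstoD(1)[OF id this] pos show ?thesis
          by eventually_elim (use False in \<open>simp add: less_inverse_gauge_iff\<close>)
      qed
    next
      assume a: "inverse_gauge \<phi> b < a"
      then have "0 \<le> a" using inverse_gauge_nonneg[of b] b by simp
      then have "b < \<phi> a" using a b by (simp add: inverse_gauge_less_iff)
      from order_tendstoD(2)[OF id this] pos
      show "\<forall>\<^sub>F y in at b within {0..}. inverse_gauge \<phi> y < a"
        by eventually_elim (use \<open>0 \<le> a\<close> in \<open>simp add: inverse_gauge_less_iff\<close>)
    }
  qed
  show "filterlim (inverse_gauge \<phi>) at_top at_top"
    unfolding filterlim_at_top
  proof
    fix c :: real
    \<comment> \<open>The equivalences hold for nonnegative arguments only, hence the maximum with
      0.\<close>
    define t where "t = max c 0"
    have "\<forall>\<^sub>F y in at_top. \<phi> t < y" by (rule eventually_gt_at_top)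
    then show "\<forall>\<^sub>F y in at_top. c \<le> inverse_gauge \<phi> y"
    proof eventually_elim
      case (elim y)
      moreover have "0 \<le> t" by (simp add: t_def)
      moreover have "0 \<le> y" using elim gauge_nonneg[OF gauge \<open>0 \<le> t\<close>] by simp
      ultimately have "t < inverse_gauge \<phi> y" by (simp add: less_inverse_gauge_iff)
      then show ?case by (simp add: t_def)
    qed
  qed
qed

text \<open>The defect \<open>h\<close> vanishes at 0. The subgradient inequalities of both
  primitives bound its increments by
  \<open>\<bar>s - r\<bar> * \<bar>\<phi> s - \<phi> r\<bar>\<close>, so continuity of
  \<open>\<phi>\<close> alone makes its derivative zero.\<close>

lemma young_equality:
  assumes "0 \<le> a"
  shows "integral {0..a} \<phi> + integral {0..\<phi> a} (inverse_gauge \<phi>) = a * \<phi> a"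
proof -
  define h where
    "h = (\<lambda>a. integral {0..a} \<phi> + integral {0..\<phi> a} (inverse_gauge \<phi>) - a * \<phi> a)"
  have upper: "h s - h r \<le> (s - r) * (\<phi> s - \<phi> r)" if "0 \<le> r" "0 \<le> s" for r s
    using gauge_integral_diff_ge[OF gauge, of s r]
      gauge_integral_diff_ge[OF gauge_function_inverse, of "\<phi> s" "\<phi> r"] that
    by (simp add: h_def gauge_nonneg[OF gauge] inverse_gauge_gauge algebra_simps)
  have bound: "\<bar>h s - h r\<bar> \<le> \<bar>s - r\<bar> * \<bar>\<phi> s - \<phi> r\<bar>" if "0 \<le> r" "0 \<le> s" for r s
  proof -
    have "h s - h r \<le> \<bar>(s - r) * (\<phi> s - \<phi> r)\<bar>" "h r - h s \<le> \<bar>(s - r) * (\<phi> s - \<phi> r)\<bar>"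
      using upper[OF that] upper[OF that(2,1)] by (auto simp: algebra_simps)
    then show ?thesis unfolding abs_mult[symmetric] by linarith
  qed
  have "(h has_field_derivative 0) (at r within {0..})" if "r \<in> {0..}" for r
    unfolding has_field_derivative_iff
  proof (rule Lim_null_comparison)
    show "\<forall>\<^sub>F s in at r within {0..}. norm ((h s - h r) / (s - r)) \<le> \<bar>\<phi> s - \<phi> r\<bar>"
      unfolding eventually_at_filter
      using bound[of r] that by (auto simp: divide_le_eq mult.commute intro!: always_eventually)
    have "(\<phi> \<longlongrightarrow> \<phi> r) (at r within {0..})"
      using gauge_continuous_on[OF gauge] that by (simp add: continuous_on_def)
    then show "((\<lambda>s. \<bar>\<phi> s - \<phi> r\<bar>) \<longlongrightarrow> 0) (at r within {0..})"
      by (intro tendsto_rabs_zero) (simp add: LIM_zero_iff)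
  qed
  then obtain c where c: "\<And>r. r \<in> {0..} \<Longrightarrow> h r = c"
    using has_field_derivative_zero_constant[of "{0..}" h] by auto
  have "h a = h 0" using c assms by simp
  also have "\<dots> = 0" by (simp add: h_def gauge_zero[OF gauge])
  finally show ?thesis by (simp add: h_def)
qed

end

section \<open>The duality map\<close>

text \<open>The parameter \<open>X\<close> only makes the type of the space instantiable in interpretations.\<close>

locale smooth_space =
  fixes \<phi> :: "real \<Rightarrow> real" and X :: "'a::banach itself"
  assumes gauge: "gauge_function \<phi>"
    and frechet: "frechet_differentiable_space TYPE('a)"
begin

abbreviation j :: "'a \<Rightarrow> 'a \<Rightarrow>\<^sub>L real" where "j \<equiv> duality_map \<phi>"

text \<open>Divided by \<open>\<phi> (norm x)\<close>, any element of the set is a norm-one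
  functional supporting \<open>x\<close>, hence equals the derivative \<open>u\<close>.\<close>

lemma duality_set_nonzero:
  fixes x :: 'a
  assumes "(norm has_derivative blinfun_apply u) (at x)" "x \<noteq> 0"
  shows "duality_set \<phi> x = {\<phi> (norm x) *\<^sub>R u}"
proof -
  have pos: "\<phi> (norm x) > 0" using gauge_pos[OF gauge] assms(2) by simp
  have "y = \<phi> (norm x) *\<^sub>R u" if "y \<in> duality_set \<phi> x" for y
  proof -
    have "(1 / \<phi> (norm x)) *\<^sub>R y = u"
      by (rule support_unique[OF assms(1)])
        (use that pos in \<open>auto simp: duality_set_def scaleR_blinfun.rep_eq\<close>)
    then show ?thesis using pos by auto
  qed
  moreover have "\<phi> (norm x) *\<^sub>R u \<in> duality_set \<phi> x"
    using norm_derivative_support[OF assms] pos by (simp add: duality_set_def scaleR_blinfun.rep_eq)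
  ultimately show ?thesis by blast
qed

lemma duality_set_eq: "duality_set \<phi> (x :: 'a) = {j x}"
proof -
  have "\<exists>y. duality_set \<phi> x = {y}"
  proof (cases "x = 0")
    case True
    then show ?thesis by (auto simp: duality_set_def gauge_zero[OF gauge])
  next
    case False
    then show ?thesis using frechet_support[OF frechet False] duality_set_nonzero by metis
  qed
  then show ?thesis unfolding duality_map_def by auto
qed

lemma norm_j: "norm (j x) = \<phi> (norm x)"
  and j_self: "j x x = \<phi> (norm x) * norm x"
proof -
  have "j x \<in> duality_set \<phi> x" by (simp add: duality_set_eq)
  then show "norm (j x) = \<phi> (norm x)" "j x x = \<phi> (norm x) * norm x"
    by (auto simp: duality_set_def)
qed

lemma j_eqI:
  assumes "blinfun_apply y x = norm x * norm y" "norm y = \<phi> (norm x)"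
  shows "j x = y"
proof -
  have "y \<in> duality_set \<phi> x" using assms by (simp add: duality_set_def)
  then show ?thesis by (simp add: duality_set_eq)
qed

lemma j_zero: "j 0 = 0"
  by (rule j_eqI) (auto simp: gauge_zero[OF gauge])

lemma continuous_gauge_norm: "continuous_on UNIV (\<lambda>x :: 'a. \<phi> (norm x))"
  by (rule continuous_on_compose2[OF gauge_continuous_on[OF gauge]]) (auto intro!: continuous_intros)

lemma continuous_j: "continuous_on UNIV j"
  unfolding continuous_on_def
proof
  fix x :: 'a
  have gn: "((\<lambda>y :: 'a. \<phi> (norm y)) \<longlongrightarrow> \<phi> (norm x)) (at x)"
    using continuous_gauge_norm by (auto simp: continuous_on_def)
  show "(j \<longlongrightarrow> j x) (at x)"
  proof (cases "x = 0")
    case True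
    have "(j \<longlongrightarrow> 0) (at x)"
      by (rule tendsto_norm_zero_cancel) (use gn True in \<open>simp add: norm_j gauge_zero[OF gauge]\<close>)
    then show ?thesis using True by (simp add: j_zero)
  next
    case False
    obtain u where u: "(norm has_derivative blinfun_apply u) (at x)"
      using frechet_support[OF frechet False] by blast
    \<comment> \<open>Unit support functionals at \<open>y\<close>; at \<open>y = 0\<close> division
      by zero gives 0, consistent with \<open>j 0 = 0\<close>. They nearly norm \<open>x\<close> for
      \<open>y\<close> near \<open>x\<close>, so Shmul'yan's argument applies.\<close>
    define v where "v = (\<lambda>y. (1 / \<phi> (norm y)) *\<^sub>R j y)"
    have v1: "norm (v y) \<le> 1" for y
      using gauge_nonneg[OF gauge, of "norm y"] by (simp add: v_def norm_j)
    have jv: "j y = \<phi> (norm y) *\<^sub>R v y" for y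
      using gauge_pos[OF gauge, of "norm y"] by (cases "y = 0") (auto simp: v_def j_zero)
    have vy: "v y y = norm y" for y
      using gauge_pos[OF gauge, of "norm y"]
      by (cases "y = 0") (auto simp: v_def j_self scaleR_blinfun.rep_eq)
    have "((\<lambda>y. v y x) \<longlongrightarrow> norm x) (at x)"
    proof (rule Lim_transform)
      show "((\<lambda>y. norm y) \<longlongrightarrow> norm x) (at x)" by (intro tendsto_intros)
      show "((\<lambda>y. v y x - norm y) \<longlongrightarrow> 0) (at x)"
      proof (rule Lim_null_comparison)
        show "\<forall>\<^sub>F y in at x. norm (v y x - norm y) \<le> norm (x - y)"
        proof (rule always_eventually, rule allI)
          fix y
          have "norm (v y x - norm y) = norm (v y (x - y))" by (simp add: blinfun.diff_right vy)
          also have "\<dots> \<le> norm (v y) * norm (x - y)" by (rule norm_blinfun)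
          also have "\<dots> \<le> norm (x - y)" using v1[of y] by (simp add: mult_left_le_one_le)
          finally show "norm (v y x - norm y) \<le> norm (x - y)" .
        qed
        show "((\<lambda>y. norm (x - y)) \<longlongrightarrow> 0) (at x)"
          by (intro tendsto_eq_intros) auto
      qed
    qed
    then have "(v \<longlongrightarrow> u) (at x)"
      using v1 by (intro smulian[OF u]) auto
    then have "((\<lambda>y. \<phi> (norm y) *\<^sub>R v y) \<longlongrightarrow> \<phi> (norm x) *\<^sub>R u) (at x)"
      by (intro tendsto_intros gn)
    moreover have "j x = \<phi> (norm x) *\<^sub>R u"
      using duality_set_nonzero[OF u False] duality_set_eq[of x] by auto
    ultimately show ?thesis by (simp add: jv[symmetric])
  qed
qed

lemma tendsto_j: "(f \<longlongrightarrow> x) F \<Longrightarrow> ((\<lambda>n. j (f n)) \<longlongrightarrow> j x) F"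
  by (rule continuous_on_tendsto_compose[OF continuous_j]) auto

lemma j_le: "j y x \<le> \<phi> (norm y) * norm x"
  using norm_blinfun[of "j y" x] by (simp add: norm_j)

lemma Psi_subgradient: "Psi \<phi> y + j y (x - y) \<le> Psi \<phi> x"
  using j_le[of y x] gauge_integral_diff_ge[OF gauge, of "norm y" "norm x"]
  by (simp add: Psi_def blinfun.diff_right j_self algebra_simps)

text \<open>The subgradients at \<open>x\<close> and at \<open>y\<close> enclose the increment, and
  continuity of \<open>j\<close> sends both bounds to 0.\<close>

lemma continuous_Psi: "continuous_on UNIV (Psi \<phi> :: 'a \<Rightarrow> real)"
  unfolding continuous_on_def
proof
  fix x :: 'a
  have "((\<lambda>y. Psi \<phi> y - Psi \<phi> x) \<longlongrightarrow> 0) (at x)"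
  proof (rule tendsto_sandwich)
    show "\<forall>\<^sub>F y in at x. j x (y - x) \<le> Psi \<phi> y - Psi \<phi> x"
      using Psi_subgradient[of x] by (simp add: algebra_simps)
    have "Psi \<phi> y - Psi \<phi> x \<le> j y (y - x)" for y
      using Psi_subgradient[of y x] by (simp add: blinfun.diff_right)
    then show "\<forall>\<^sub>F y in at x. Psi \<phi> y - Psi \<phi> x \<le> j y (y - x)" by simp
    show "((\<lambda>y. j x (y - x)) \<longlongrightarrow> 0) (at x)"
      by (rule tendsto_eq_intros | simp)+
    have "((\<lambda>y. j y (y - x)) \<longlongrightarrow> j x (x - x)) (at x)"
      by (intro tendsto_intros tendsto_j)
    then show "((\<lambda>y. j y (y - x)) \<longlongrightarrow> 0) (at x)" by simp
  qed
  then show "(Psi \<phi> \<longlongrightarrow> Psi \<phi> x) (at x)" by (simp add: LIM_zero_iff)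
qed

text \<open>Superlinear growth: the tangent to the primitive of \<open>\<phi>\<close> at a point
  \<open>r\<close> with \<open>\<phi> r \<ge> c\<close> lies below the primitive.\<close>

lemma Psi_coercive: "\<exists>C. \<forall>z :: 'a. c * norm z - C \<le> Psi \<phi> z"
proof -
  obtain r where r: "r \<ge> 0" "c \<le> \<phi> r" using gauge_unbounded[OF gauge] by blast
  have "c * norm z - (\<phi> r * r - integral {0..r} \<phi>) \<le> Psi \<phi> z" for z :: 'a
    using gauge_integral_diff_ge[OF gauge r(1), of "norm z"] mult_right_mono[OF r(2), of "norm z"]
    by (simp add: Psi_def algebra_simps)
  then show ?thesis by blast
qed

lemma tendsto_norm_if_tendsto_Psi:
  fixes x :: "nat \<Rightarrow> 'a"
  assumes "((\<lambda>n. Psi \<phi> (x n)) \<longlongrightarrow> Psi \<phi> y) F"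
  shows "((\<lambda>n. norm (x n)) \<longlongrightarrow> norm y) F"
proof (rule order_tendstoI)
  fix a assume a: "a < norm y"
  show "\<forall>\<^sub>F n in F. a < norm (x n)"
  proof (cases "a < 0")
    case True
    then show ?thesis by (intro always_eventually allI less_le_trans[OF True norm_ge_zero])
  next
    case False
    then have "\<forall>\<^sub>F n in F. integral {0..a} \<phi> < Psi \<phi> (x n)"
      using a gauge_integral_less_iff[OF gauge, of a "norm y"]
      by (intro order_tendstoD(1)[OF assms]) (simp add: Psi_def)
    then show ?thesis
      using False gauge_integral_less_iff[OF gauge] by (auto simp: Psi_def)
  qed
next
  fix a assume a: "norm y < a"
  then have "a \<ge> 0" by (meson norm_ge_zero less_imp_le order_trans)
  then have "\<forall>\<^sub>F n in F. Psi \<phi> (x n) < integral {0..a} \<phi>"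
    using a gauge_integral_less_iff[OF gauge, of "norm y" a]
    by (intro order_tendstoD(2)[OF assms]) (simp add: Psi_def)
  then show "\<forall>\<^sub>F n in F. norm (x n) < a"
    using \<open>a \<ge> 0\<close> gauge_integral_less_iff[OF gauge] by (auto simp: Psi_def)
qed

end

section \<open>Minimisers and the left projection\<close>

text \<open>All these hypotheses pass to the dual with the inverse gauge, so the results below are
  used there as well.\<close>

locale bregman_space = smooth_space \<phi> X for \<phi> :: "real \<Rightarrow> real" and X :: "'a::banach itself" +
  assumes strictly_convex: "strictly_convex_space TYPE('a)"
    and reflexive: "reflexive_space TYPE('a)"
    and radon_riesz: "radon_riesz_space TYPE('a)"
begin

text \<open>Strict subgradient inequality. Equality first forces \<open>norm x = norm y\<close> by
  strictness for the gauge; the midpoint \<open>w\<close> of the normalised vectors would then have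
  norm below 1 and yet \<open>j y w \<ge> \<phi> r\<close>.\<close>

lemma Psi_subgradient_eqD:
  assumes "Psi \<phi> x \<le> Psi \<phi> y + j y (x - y)"
  shows "x = y"
proof (rule ccontr)
  assume "x \<noteq> y"
  have diff: "Psi \<phi> x - Psi \<phi> y \<le> j y x - \<phi> (norm y) * norm y"
    using assms by (simp add: blinfun.diff_right j_self)
  then have eq: "norm x = norm y"
    using gauge_integral_diff_greater[OF gauge, of "norm y" "norm x"] j_le[of y x]
    by (cases "norm x = norm y") (auto simp: Psi_def algebra_simps)
  define r where "r = norm y"
  have r: "r > 0" using eq \<open>x \<noteq> y\<close> by (auto simp: r_def)
  have jx: "j y x \<ge> \<phi> r * r" using diff by (simp add: Psi_def eq r_def)
  define w where "w = (1/2) *\<^sub>R ((1/r) *\<^sub>R x + (1/r) *\<^sub>R y)"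
  have "norm w < 1"
    using strictly_convex r eq \<open>x \<noteq> y\<close>
    unfolding strictly_convex_space_def w_def by (auto simp: r_def)
  then have "j y w < \<phi> r"
    using j_le[of y w] gauge_pos[OF gauge r] mult_strict_left_mono[of "norm w" 1 "\<phi> r"]
    unfolding r_def by linarith
  moreover have "j y w = (j y x + \<phi> r * r) / (2 * r)"
    by (simp add: w_def blinfun.add_right blinfun.scaleR_right j_self r_def field_simps)
  ultimately show False using r jx by (simp add: field_simps)
qed

text \<open>Coercivity bounds the \<open>x n\<close>, which yields a weak cluster point
  \<open>z\<close>. Testing it with the subgradient \<open>j z - f\<close> at \<open>z\<close>
  itself gives weak lower semicontinuity.\<close>

lemma Psi_weak_cluster_point:
  fixes x :: "'i \<Rightarrow> 'a"
  assumes "G \<noteq> bot" "((\<lambda>n. Psi \<phi> (x n) - blinfun_apply f (x n)) \<longlongrightarrow> m) G"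
  obtains z where "Psi \<phi> z - blinfun_apply f z \<le> m"
    "\<And>(g :: 'a \<Rightarrow>\<^sub>L real) c. \<forall>\<^sub>F n in G. g (x n) \<le> c \<Longrightarrow> g z \<le> c"
proof -
  \<comment> \<open>The slope exceeds \<open>norm f\<close> by 1, which leaves one copy of the norm
    to be bounded.\<close>
  obtain C where C: "\<And>z :: 'a. (norm f + 1) * norm z - C \<le> Psi \<phi> z" using Psi_coercive by blast
  have upper: "\<forall>\<^sub>F n in G. Psi \<phi> (x n) - blinfun_apply f (x n) < m + e" if "e > 0" for e
    using that by (intro order_tendstoD(2)[OF assms(2)]) simp
  have "\<forall>\<^sub>F n in G. norm (x n) \<le> m + 1 + C"
    using upper[OF zero_less_one]
  proof eventually_elim
    case (elim n)
    have "f (x n) \<le> norm f * norm (x n)" using norm_blinfun[of f "x n"] by simp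
    then show ?case using elim C[of "x n"] by (simp add: algebra_simps)
  qed
  then obtain z where z: "\<And>(g :: 'a \<Rightarrow>\<^sub>L real) c. \<forall>\<^sub>F n in G. g (x n) \<le> c \<Longrightarrow> g z \<le> c"
    using weak_cluster_point[OF reflexive assms(1)] by blast
  have "Psi \<phi> z - f z \<le> m + e" if "e > 0" for e
  proof -
    have "(j z - f) z \<le> m + e - Psi \<phi> z + j z z"
    proof (rule z)
      show "\<forall>\<^sub>F n in G. (j z - f) (x n) \<le> m + e - Psi \<phi> z + j z z"
        using upper[OF that]
      proof eventually_elim
        case (elim n)
        then show ?case
          using Psi_subgradient[of z "x n"] by (simp add: blinfun.diff_right minus_blinfun.rep_eq)
      qed
    qed
    then show ?thesis by (simp add: minus_blinfun.rep_eq)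
  qed
  then have "Psi \<phi> z - f z \<le> m" by (rule field_le_epsilon)
  then show ?thesis using that z by blast
qed

text \<open>The linear tilt \<open>f\<close> covers two problems at once: \<open>f = j y\<close>
  gives the left projection of \<open>y\<close>, and \<open>K = UNIV\<close> gives the equation
  \<open>j x = f\<close>.\<close>

definition is_minimizer :: "'a set \<Rightarrow> ('a \<Rightarrow>\<^sub>L real) \<Rightarrow> 'a \<Rightarrow> bool" where
  "is_minimizer K f x \<longleftrightarrow> x \<in> K \<and> (\<forall>z\<in>K. Psi \<phi> x - f x \<le> Psi \<phi> z - f z)"

text \<open>Direct method: a weak cluster point of a minimising sequence has value at most the
  infimum, and separation keeps it in \<open>K\<close>.\<close>

lemma minimizer_exists:
  assumes "convex K" "closed K" "K \<noteq> {}"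
  shows "\<exists>x. is_minimizer K f x"
proof -
  define h where "h = (\<lambda>z. Psi \<phi> z - f z)"
  obtain C where C: "\<And>z :: 'a. norm f * norm z - C \<le> Psi \<phi> z" using Psi_coercive by blast
  have "- C \<le> h z" for z
    using C[of z] norm_blinfun[of f z] by (simp add: h_def)
  then have bdd: "bdd_below (h ` K)" by (auto simp: bdd_below_def)
  define m where "m = Inf (h ` K)"
  have "m \<in> closure (h ` K)"
    unfolding m_def using assms(3) bdd by (intro closure_contains_Inf) auto
  then obtain y where y: "\<And>n. y n \<in> h ` K" "y \<longlonglongrightarrow> m"
    unfolding closure_sequential by blast
  then have "\<forall>n. \<exists>z. z \<in> K \<and> y n = h z" by blast
  then obtain x where x: "\<And>n. x n \<in> K" "\<And>n. y n = h (x n)"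
    using choice[of "\<lambda>n z. z \<in> K \<and> y n = h z"] by blast
  have lim: "(\<lambda>n. Psi \<phi> (x n) - f (x n)) \<longlonglongrightarrow> m"
  proof -
    have "y = (\<lambda>n. Psi \<phi> (x n) - f (x n))" using x(2) unfolding h_def by (rule ext)
    then show ?thesis using y(2) by simp
  qed
  obtain z where z: "Psi \<phi> z - f z \<le> m"
    "\<And>(g :: 'a \<Rightarrow>\<^sub>L real) c. \<forall>\<^sub>F n in sequentially. g (x n) \<le> c \<Longrightarrow> g z \<le> c"
    using Psi_weak_cluster_point[OF trivial_limit_sequentially lim] by blast
  have "z \<in> K"
  proof (rule ccontr)
    assume "z \<notin> K"
    then obtain g :: "'a \<Rightarrow>\<^sub>L real" and c where g: "g z > c" "\<And>k. k \<in> K \<Longrightarrow> g k \<le> c"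
      using closed_convex_separation[OF assms(1,2)] by blast
    then show False using z(2)[of g c] x(1) by simp
  qed
  moreover have "h z \<le> h k" if "k \<in> K" for k
    using z(1) cInf_lower[OF _ bdd, of "h k"] that by (simp add: m_def h_def)
  ultimately show ?thesis by (auto simp: is_minimizer_def h_def)
qed

text \<open>Minimality and the subgradient inequality at \<open>x + t *\<^sub>R v\<close> give the
  claim with \<open>j (x + t *\<^sub>R v)\<close>; then \<open>t\<close> tends to 0 from the
  right.\<close>

lemma minimizer_variational:
  assumes x: "is_minimizer K f x" and "convex K" "z \<in> K"
  shows "f (z - x) \<le> j x (z - x)"
proof -
  define v where "v = z - x"
  have "((\<lambda>t. j (x + t *\<^sub>R v) v) \<longlongrightarrow> j (x + 0 *\<^sub>R v) v) (at_right 0)"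
    by (intro tendsto_intros tendsto_j)
  then have "((\<lambda>t. j (x + t *\<^sub>R v) v) \<longlongrightarrow> j x v) (at_right 0)" by simp
  moreover have "\<forall>\<^sub>F t in at_right 0. f v \<le> j (x + t *\<^sub>R v) v"
    using eventually_at_right_real[of 0 1, OF zero_less_one]
  proof eventually_elim
    case (elim t)
    then have t: "0 < t" "t < 1" by auto
    have "(1 - t) *\<^sub>R x + t *\<^sub>R z \<in> K"
      using assms t by (intro convexD) (auto simp: is_minimizer_def)
    then have "x + t *\<^sub>R v \<in> K" by (simp add: v_def algebra_simps)
    then have "Psi \<phi> x - f x \<le> Psi \<phi> (x + t *\<^sub>R v) - f (x + t *\<^sub>R v)"
      using x by (simp add: is_minimizer_def)
    moreover have "Psi \<phi> (x + t *\<^sub>R v) + j (x + t *\<^sub>R v) (x - (x + t *\<^sub>R v)) \<le> Psi \<phi> x"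
      by (rule Psi_subgradient)
    ultimately have "t * f v \<le> t * j (x + t *\<^sub>R v) v"
      by (simp add: blinfun.add_right blinfun.scaleR_right blinfun.minus_right)
    then show ?case using t by simp
  qed
  ultimately show ?thesis
    unfolding v_def[symmetric] by (intro tendsto_lowerbound) auto
qed

lemma minimizer_bregman_le:
  assumes x: "is_minimizer K f x" and "convex K" "z \<in> K"
  shows "bregman_Psi \<phi> z x \<le> (Psi \<phi> z - f z) - (Psi \<phi> x - f x)"
  using minimizer_variational[OF assms] by (simp add: bregman_Psi_def blinfun.diff_right)

lemma bregman_nonneg: "0 \<le> bregman_Psi \<phi> x (y :: 'a)"
  using Psi_subgradient[of y x] by (simp add: bregman_Psi_def)

lemma bregman_le_zeroD: "bregman_Psi \<phi> x (y :: 'a) \<le> 0 \<Longrightarrow> x = y"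
  by (rule Psi_subgradient_eqD) (simp add: bregman_Psi_def)

lemma minimizer_unique:
  assumes "is_minimizer K f x" "is_minimizer K f y" "convex K"
  shows "x = y"
proof (rule bregman_le_zeroD)
  have "Psi \<phi> x - f x \<le> Psi \<phi> y - f y" "x \<in> K"
    using assms(1,2) unfolding is_minimizer_def by blast+
  then show "bregman_Psi \<phi> x y \<le> 0"
    using minimizer_bregman_le[OF assms(2,3), of x] by linarith
qed

text \<open>Every weak cluster point satisfies the equality case of the subgradient inequality and
  so is \<open>y\<close>, which gives weak convergence. Then \<open>Psi \<phi> (x n)\<close> and
  hence the norms converge, and the Radon--Riesz property applies.\<close>

lemma bregman_tendsto_zero_imp_tendsto:
  fixes x :: "nat \<Rightarrow> 'a"
  assumes "(\<lambda>n. bregman_Psi \<phi> (x n) y) \<longlonglongrightarrow> 0"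
  shows "x \<longlonglongrightarrow> y"
proof -
  have "(\<lambda>n. bregman_Psi \<phi> (x n) y + (Psi \<phi> y - j y y)) \<longlonglongrightarrow> 0 + (Psi \<phi> y - j y y)"
    by (intro tendsto_intros assms)
  then have lim: "(\<lambda>n. Psi \<phi> (x n) - j y (x n)) \<longlonglongrightarrow> Psi \<phi> y - j y y"
    by (simp add: bregman_Psi_def blinfun.diff_right)
  have lower: "\<forall>\<^sub>F n in sequentially. a < g (x n)" if a: "a < g y" for a and g :: "'a \<Rightarrow>\<^sub>L real"
  proof (rule ccontr)
    assume neg: "\<not> (\<forall>\<^sub>F n in sequentially. a < g (x n))"
    \<comment> \<open>Restricting the filter to the offending indices replaces passing to a
      subsequence.\<close>
    define G where "G = inf sequentially (principal {n. g (x n) \<le> a})"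
    have G: "G \<noteq> bot"
      using neg by (simp add: G_def trivial_limit_def eventually_inf_principal not_le)
    have "((\<lambda>n. Psi \<phi> (x n) - j y (x n)) \<longlongrightarrow> Psi \<phi> y - j y y) G"
      by (rule tendsto_mono[OF _ lim]) (simp add: G_def)
    then obtain z where z: "Psi \<phi> z - j y z \<le> Psi \<phi> y - j y y"
      "\<And>(g :: 'a \<Rightarrow>\<^sub>L real) c. \<forall>\<^sub>F n in G. g (x n) \<le> c \<Longrightarrow> g z \<le> c"
      using Psi_weak_cluster_point[OF G] by blast
    have "z = y" by (rule Psi_subgradient_eqD) (use z(1) in \<open>simp add: blinfun.diff_right\<close>)
    moreover have "g z \<le> a" by (rule z(2)) (simp add: G_def eventually_inf_principal)
    ultimately show False using a by simp
  qed
  have weak: "weakly_tendsto x y"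
    unfolding weakly_tendsto_def
  proof (intro allI order_tendstoI)
    fix g :: "'a \<Rightarrow>\<^sub>L real" and a
    show "a < g y \<Longrightarrow> \<forall>\<^sub>F n in sequentially. a < g (x n)" by (rule lower)
    show "g y < a \<Longrightarrow> \<forall>\<^sub>F n in sequentially. g (x n) < a"
      using lower[of "- a" "- g"] by (simp add: uminus_blinfun.rep_eq)
  qed
  then have "(\<lambda>n. j y (x n)) \<longlonglongrightarrow> j y y" by (simp add: weakly_tendsto_def)
  from tendsto_add[OF lim this] have "(\<lambda>n. Psi \<phi> (x n)) \<longlonglongrightarrow> Psi \<phi> y" by simp
  then have "(\<lambda>n. norm (x n)) \<longlonglongrightarrow> norm y" by (rule tendsto_norm_if_tendsto_Psi)
  then have "(\<lambda>n. norm (x n - y)) \<longlonglongrightarrow> 0"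
    using radon_riesz weak unfolding radon_riesz_space_def by blast
  then show ?thesis by (simp add: tendsto_norm_zero_iff LIM_zero_iff)
qed

text \<open>The distance \<open>bregman_Psi \<phi> (x n) y\<close> is at most the excess of
  \<open>x n\<close> in the limit problem, which is of order \<open>norm (f n - g)\<close> once the
  \<open>x n\<close> are bounded.\<close>

lemma minimizer_tendsto:
  fixes x :: "nat \<Rightarrow> 'a"
  assumes "convex K" "f \<longlonglongrightarrow> g"
    and x: "\<And>n. is_minimizer K (f n) (x n)" and y: "is_minimizer K g y"
  shows "x \<longlonglongrightarrow> y"
proof -
  have le: "bregman_Psi \<phi> (x n) y \<le> norm (f n - g) * (norm (x n) + norm y)" for n
  proof -
    have "bregman_Psi \<phi> (x n) y \<le> (Psi \<phi> (x n) - g (x n)) - (Psi \<phi> y - g y)"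
      using x[of n] by (intro minimizer_bregman_le[OF y assms(1)]) (simp add: is_minimizer_def)
    \<comment> \<open>Minimality of \<open>x n\<close> for \<open>f n\<close>, tested against
      \<open>y\<close>.\<close>
    also have "\<dots> \<le> (f n - g) (x n - y)"
      using x[of n] y by (force simp: is_minimizer_def blinfun.diff_right minus_blinfun.rep_eq)
    also have "\<dots> \<le> norm (f n - g) * norm (x n - y)"
      using norm_blinfun[of "f n - g" "x n - y"] by simp
    also have "\<dots> \<le> norm (f n - g) * (norm (x n) + norm y)"
      by (intro mult_left_mono norm_triangle_ineq4) simp
    finally show ?thesis .
  qed
  \<comment> \<open>Of the slope, \<open>norm (j y)\<close> absorbs \<open>j y (x n)\<close> and 1
    absorbs the perturbation; the remaining 1 bounds \<open>norm (x n)\<close>.\<close>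
  obtain C where C: "\<And>z :: 'a. (norm (j y) + 2) * norm z - C \<le> Psi \<phi> z" using Psi_coercive by blast
  define B where "B = C + Psi \<phi> y + \<bar>j y y\<bar> + norm y"
  have fg: "(\<lambda>n. norm (f n - g)) \<longlonglongrightarrow> 0"
    using assms(2) by (simp add: tendsto_norm_zero_iff LIM_zero_iff)
  then have "\<forall>\<^sub>F n in sequentially. norm (f n - g) < 1"
    by (rule order_tendstoD) simp
  then have "\<forall>\<^sub>F n in sequentially. norm (x n) \<le> B"
  proof eventually_elim
    case (elim n)
    have "norm (f n - g) * (norm (x n) + norm y) \<le> norm (x n) + norm y"
      using elim by (intro mult_left_le_one_le) auto
    moreover have "j y (x n) \<le> norm (j y) * norm (x n)"
      using norm_blinfun[of "j y" "x n"] by simp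
    ultimately show ?case
      using le[of n] C[of "x n"]
      by (simp add: B_def bregman_Psi_def blinfun.diff_right algebra_simps)
  qed
  then have "\<forall>\<^sub>F n in sequentially. norm (bregman_Psi \<phi> (x n) y) \<le> norm (f n - g) * (B + norm y)"
  proof eventually_elim
    case (elim n)
    then have "norm (f n - g) * (norm (x n) + norm y) \<le> norm (f n - g) * (B + norm y)"
      by (intro mult_left_mono) auto
    then show ?case using le[of n] bregman_nonneg[of "x n" y] by simp
  qed
  moreover have "(\<lambda>n. norm (f n - g) * (B + norm y)) \<longlonglongrightarrow> 0"
    using tendsto_mult_right[OF fg, of "B + norm y"] by simp
  ultimately have "(\<lambda>n. bregman_Psi \<phi> (x n) y) \<longlonglongrightarrow> 0"
    by (rule Lim_null_comparison)
  then show ?thesis by (rule bregman_tendsto_zero_imp_tendsto)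
qed

section \<open>The left projection and the distance function\<close>

lemma is_minimizer_iff_bregman:
  "is_minimizer K (j y) x \<longleftrightarrow> x \<in> K \<and> (\<forall>z\<in>K. bregman_Psi \<phi> x y \<le> bregman_Psi \<phi> z y)"
  by (simp add: is_minimizer_def bregman_Psi_def blinfun.diff_right)

lemma left_projection_is_minimizer:
  assumes "convex K" "closed K" "K \<noteq> {}"
  shows "is_minimizer K (j y) (left_projection \<phi> K y)"
proof -
  have "\<exists>!x. is_minimizer K (j y) x"
    using minimizer_exists[OF assms] minimizer_unique assms(1) by blast
  then show ?thesis
    unfolding left_projection_def is_minimizer_iff_bregman[symmetric] by (rule theI')
qed

lemma continuous_left_projection:
  assumes "convex K" "closed K" "(K :: 'a set) \<noteq> {}"
  shows "continuous_on UNIV (left_projection \<phi> K)"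
  unfolding continuous_on_sequentially comp_def
proof (intro allI ballI impI)
  fix x :: "nat \<Rightarrow> 'a" and a assume "(\<forall>n. x n \<in> UNIV) \<and> x \<longlonglongrightarrow> a"
  then have "x \<longlonglongrightarrow> a" by blast
  then have "(\<lambda>n. j (x n)) \<longlonglongrightarrow> j a" by (rule tendsto_j)
  then show "(\<lambda>n. left_projection \<phi> K (x n)) \<longlonglongrightarrow> left_projection \<phi> K a"
    by (rule minimizer_tendsto[OF assms(1)]) (rule left_projection_is_minimizer[OF assms])+
qed

text \<open>The infimum is attained at the left projection, so the function is composed of
  continuous maps.\<close>

lemma continuous_bregman_distance:
  assumes "convex K" "closed K" "(K :: 'a set) \<noteq> {}"
  shows "continuous_on UNIV (\<lambda>x. INF y\<in>K. bregman_Psi \<phi> y x)"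
proof -
  have "(INF y\<in>K. bregman_Psi \<phi> y x) = bregman_Psi \<phi> (left_projection \<phi> K x) x" for x
  proof (rule cInf_eq_minimum)
    have *: "is_minimizer K (j x) (left_projection \<phi> K x)"
      by (rule left_projection_is_minimizer[OF assms])
    show "bregman_Psi \<phi> (left_projection \<phi> K x) x \<in> (\<lambda>y. bregman_Psi \<phi> y x) ` K"
      using * unfolding is_minimizer_iff_bregman by blast
    show "bregman_Psi \<phi> (left_projection \<phi> K x) x \<le> b" if "b \<in> (\<lambda>y. bregman_Psi \<phi> y x) ` K" for b
      using * that unfolding is_minimizer_iff_bregman by blast
  qed
  moreover have "continuous_on UNIV (\<lambda>x. Psi \<phi> (left_projection \<phi> K x))"
    by (rule continuous_on_compose2[OF continuous_Psi continuous_left_projection[OF assms]]) simp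
  then have "continuous_on UNIV (\<lambda>x. bregman_Psi \<phi> (left_projection \<phi> K x) x)"
    unfolding bregman_Psi_def
    by (intro continuous_intros continuous_j continuous_Psi continuous_left_projection[OF assms])
  ultimately show ?thesis by simp
qed

text \<open>On the whole space the variational inequality holds for \<open>v\<close> and
  \<open>- v\<close>, hence is an equation. Existence, uniqueness and stability of minimisers thus
  become surjectivity, injectivity and inverse continuity of \<open>j\<close>.\<close>

lemma is_minimizer_UNIV_iff: "is_minimizer UNIV f x \<longleftrightarrow> j x = f"
proof
  assume *: "is_minimizer UNIV f x"
  have "f v \<le> j x v" for v
    using minimizer_variational[OF *, of "x + v"] by simp
  from this this[of "- _"] show "j x = f"
    by (intro blinfun_eqI order_antisym) (auto simp: blinfun.minus_right)
next
  assume "j x = f"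
  then show "is_minimizer UNIV f x"
    using Psi_subgradient[of x] by (auto simp: is_minimizer_def blinfun.diff_right algebra_simps)
qed

lemma bij_j: "bij j"
proof (rule bijI)
  show "inj j"
    by (rule injI, rule minimizer_unique[OF _ _ convex_UNIV]) (auto simp: is_minimizer_UNIV_iff)
  show "surj j"
    using minimizer_exists[OF convex_UNIV closed_UNIV UNIV_not_empty]
    unfolding is_minimizer_UNIV_iff surj_def by metis
qed

lemma continuous_inv_j: "continuous_on UNIV (inv j)"
  unfolding continuous_on_sequentially comp_def
proof (intro allI ballI impI)
  fix f :: "nat \<Rightarrow> 'a \<Rightarrow>\<^sub>L real" and g assume "(\<forall>n. f n \<in> UNIV) \<and> f \<longlonglongrightarrow> g"
  then show "(\<lambda>n. inv j (f n)) \<longlonglongrightarrow> inv j g"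
    using surj_f_inv_f[OF bij_is_surj[OF bij_j]]
    by (intro minimizer_tendsto[of UNIV f g]) (auto simp: is_minimizer_UNIV_iff)
qed

end

section \<open>The dual space and the right projection\<close>

definition bidual_eval :: "'a::real_normed_vector \<Rightarrow> ('a \<Rightarrow>\<^sub>L real) \<Rightarrow>\<^sub>L real" where
  "bidual_eval x = Blinfun (\<lambda>f. blinfun_apply f x)"

lemma bidual_eval_apply [simp]: "blinfun_apply (bidual_eval x) f = blinfun_apply f x"
  unfolding bidual_eval_def
  by (simp add: bounded_linear_Blinfun_apply blinfun.bounded_linear_left)

lemma norm_bidual_eval_le: "norm (bidual_eval x) \<le> norm x"
proof (rule norm_blinfun_bound)
  show "norm (blinfun_apply (bidual_eval x) f) \<le> norm x * norm f" for f
    using norm_blinfun[of f x] by (simp add: mult.commute)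
qed simp

lemma bounded_linear_bidual_eval: "bounded_linear bidual_eval"
  by (rule bounded_linear_intro[where K = 1])
    (auto intro!: blinfun_eqI simp: norm_bidual_eval_le blinfun.add_right blinfun.scaleR_right
      plus_blinfun.rep_eq scaleR_blinfun.rep_eq)

text \<open>Restricting \<open>G\<close> to evaluations gives \<open>f\<close>; by reflexivity every
  \<open>F\<close> is an evaluation, so \<open>f\<close> represents \<open>G\<close>.\<close>

lemma reflexive_space_dual:
  assumes "reflexive_space TYPE('a::real_normed_vector)"
  shows "reflexive_space TYPE('a \<Rightarrow>\<^sub>L real)"
  unfolding reflexive_space_def
proof
  fix G :: "(('a \<Rightarrow>\<^sub>L real) \<Rightarrow>\<^sub>L real) \<Rightarrow>\<^sub>L real"
  define f where "f = Blinfun (\<lambda>x. blinfun_apply G (bidual_eval x))"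
  have f: "blinfun_apply f x = blinfun_apply G (bidual_eval x)" for x
    unfolding f_def
    by (intro bounded_linear_Blinfun_apply[THEN fun_cong]
        bounded_linear_compose[OF blinfun.bounded_linear_right bounded_linear_bidual_eval])
  have "blinfun_apply G F = blinfun_apply F f" for F
  proof -
    obtain x where "\<And>g. blinfun_apply F g = blinfun_apply g x"
      using assms unfolding reflexive_space_def by blast
    then have "F = bidual_eval x" by (intro blinfun_eqI) simp
    then show ?thesis by (simp add: f)
  qed
  then show "\<exists>f. \<forall>F. blinfun_apply G F = blinfun_apply F f" by blast
qed

section \<open>Passage of the hypotheses to the dual\<close>

context bregman_space
begin

lemma j_inv [simp]: "j (inv j f) = f"
  by (rule surj_f_inv_f[OF bij_is_surj[OF bij_j]])

lemma inv_j [simp]: "inv j (j x) = x"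
  by (rule inv_f_f[OF bij_is_inj[OF bij_j]])

lemma inv_j_eq_zero_iff: "inv j f = 0 \<longleftrightarrow> f = 0"
  using j_inv[of f] inv_j[of 0] by (metis j_zero)

text \<open>The functional \<open>j x\<close> attains its norm in direction
  \<open>x\<close>.\<close>

lemma norm_bidual_eval: "norm (bidual_eval (x :: 'a)) = norm x"
proof (rule order_antisym[OF norm_bidual_eval_le], cases "x = 0")
  case False
  then have pos: "\<phi> (norm x) > 0" by (intro gauge_pos[OF gauge]) simp
  have "\<phi> (norm x) * norm x \<le> norm (bidual_eval x) * \<phi> (norm x)"
    using norm_blinfun[of "bidual_eval x" "j x"] by (simp add: j_self norm_j)
  then show "norm x \<le> norm (bidual_eval x)" using pos by (simp add: mult.commute)
qed simp

text \<open>If the midpoint \<open>h\<close> had norm 1, it would attain it in direction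
  \<open>x = inv j h\<close>. Then \<open>f\<close> and \<open>g\<close> both support
  \<open>x\<close>, and smoothness makes them equal.\<close>

lemma dual_strictly_convex: "strictly_convex_space TYPE('a \<Rightarrow>\<^sub>L real)"
  unfolding strictly_convex_space_def
proof (intro allI impI, elim conjE, rule ccontr)
  fix f g :: "'a \<Rightarrow>\<^sub>L real"
  assume fg: "norm f = 1" "norm g = 1" "f \<noteq> g" and mid: "\<not> norm ((1/2) *\<^sub>R (f + g)) < 1"
  define h where "h = (1/2) *\<^sub>R (f + g)"
  have h: "norm h = 1"
    using mid norm_triangle_ineq[of f g] fg by (simp add: h_def)
  define x where "x = inv j h"
  have x: "\<phi> (norm x) = 1" using norm_j[of x] h by (simp add: x_def)
  then have "x \<noteq> 0" by (auto simp: gauge_zero[OF gauge])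
  then obtain u where u: "(norm has_derivative blinfun_apply u) (at x)"
    using frechet_support[OF frechet] by blast
  have "h x = norm x" using j_self[of x] x by (simp add: x_def)
  then have "f x + g x = 2 * norm x"
    by (simp add: h_def scaleR_blinfun.rep_eq plus_blinfun.rep_eq)
  moreover have "f x \<le> norm x" "g x \<le> norm x"
    using norm_blinfun[of f x] norm_blinfun[of g x] fg by auto
  ultimately have "f x = norm x" "g x = norm x" by auto
  then have "f = u" "g = u" using support_unique[OF u] fg by auto
  then show False using fg by simp
qed

text \<open>The derivative of the dual norm at \<open>f\<close> is the evaluation at the unit vector on which \<open>f\<close>
  attains its norm; it is a Frechet derivative since that vector depends continuously on \<open>f\<close>.\<close>

lemma dual_frechet: "frechet_differentiable_space TYPE('a \<Rightarrow>\<^sub>L real)"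
  unfolding frechet_differentiable_space_def
proof (intro allI impI)
  fix f :: "'a \<Rightarrow>\<^sub>L real" assume "f \<noteq> 0"
  define e where "e = (\<lambda>h. (1 / norm (inv j h)) *\<^sub>R inv j h)"
  have norming: "blinfun_apply h (e h) = norm h" for h
  proof (cases "inv j h = 0")
    case True
    then have "h = 0" by (simp add: inv_j_eq_zero_iff)
    then show ?thesis by simp
  next
    case False
    then show ?thesis
      using j_self[of "inv j h"] norm_j[of "inv j h"] by (simp add: e_def blinfun.scaleR_right)
  qed
  have e1: "norm (e h) \<le> 1" for h by (simp add: e_def)
  have le: "blinfun_apply h (e k) \<le> norm h" for h k
    using norm_blinfun[of h "e k"] mult_left_le[OF e1[of k], of "norm h"] by simp
  have "inv j f \<noteq> 0" using \<open>f \<noteq> 0\<close> by (simp add: inv_j_eq_zero_iff)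
  moreover have "(inv j \<longlongrightarrow> inv j f) (at f)"
    using continuous_inv_j by (simp add: continuous_on_def)
  ultimately have "(e \<longlongrightarrow> e f) (at f)"
    unfolding e_def by (intro tendsto_intros) auto
  then have e_lim: "((\<lambda>h. norm (e h - e f)) \<longlongrightarrow> 0) (at f)"
    by (simp add: LIM_zero_iff tendsto_norm_zero_iff)
  have "(norm has_derivative (\<lambda>h. blinfun_apply h (e f))) (at f)"
    unfolding has_derivative_iff_norm
  proof (intro conjI blinfun.bounded_linear_left Lim_null_comparison[OF always_eventually e_lim] allI)
    fix h
    have "norm h - norm f - blinfun_apply (h - f) (e f) = norm h - blinfun_apply h (e f)"
      by (simp add: norming minus_blinfun.rep_eq)
    moreover have "0 \<le> norm h - blinfun_apply h (e f)" using le[of h f] by simp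
    \<comment> \<open>This holds because \<open>f (e h) \<le> norm f\<close>. It makes the remainder
      of second order: a product of \<open>h - f\<close> and the increment of
      \<open>e\<close>.\<close>
    moreover have "norm h - blinfun_apply h (e f) \<le> blinfun_apply (h - f) (e h - e f)"
      using le[of f h] by (simp add: norming minus_blinfun.rep_eq blinfun.diff_right)
    moreover have "\<dots> \<le> norm (h - f) * norm (e h - e f)"
      using norm_blinfun[of "h - f" "e h - e f"] by simp
    ultimately have "\<bar>norm h - norm f - blinfun_apply (h - f) (e f)\<bar>
        \<le> norm (e h - e f) * norm (h - f)"
      by (simp add: mult.commute)
    then show "norm (norm (norm h - norm f - blinfun_apply (h - f) (e f)) / norm (h - f))
        \<le> norm (e h - e f)"
      by (cases "h = f") (simp_all add: divide_le_eq)
  qed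
  then show "(norm :: ('a \<Rightarrow>\<^sub>L real) \<Rightarrow> real) differentiable (at f)"
    by (rule differentiableI)
qed

text \<open>For \<open>h \<noteq> 0\<close>, weak convergence tested with evaluation at
  \<open>x = inv j h\<close> shows that the normalised \<open>g n\<close> asymptotically norm
  \<open>x\<close>; Shmul'yan's argument makes them converge in norm.\<close>

lemma dual_radon_riesz: "radon_riesz_space TYPE('a \<Rightarrow>\<^sub>L real)"
  unfolding radon_riesz_space_def
proof (intro allI impI, elim conjE)
  fix g :: "nat \<Rightarrow> 'a \<Rightarrow>\<^sub>L real" and h
  assume weak: "weakly_tendsto g h" and norms: "(\<lambda>n. norm (g n)) \<longlonglongrightarrow> norm h"
  show "(\<lambda>n. norm (g n - h)) \<longlonglongrightarrow> 0"
  proof (cases "h = 0")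
    case True
    then show ?thesis using norms by simp
  next
    case False
    define x where "x = inv j h"
    have "x \<noteq> 0" using False by (simp add: x_def inv_j_eq_zero_iff)
    then obtain u where u: "(norm has_derivative blinfun_apply u) (at x)"
      using frechet_support[OF frechet] by blast
    have hu: "h = norm h *\<^sub>R u"
      using duality_set_nonzero[OF u \<open>x \<noteq> 0\<close>] duality_set_eq[of x] norm_j[of x]
      by (simp add: x_def)
    define v where "v = (\<lambda>n. (1 / norm (g n)) *\<^sub>R g n)"
    have "(\<lambda>n. blinfun_apply (bidual_eval x) (g n)) \<longlonglongrightarrow> blinfun_apply (bidual_eval x) h"
      using weak unfolding weakly_tendsto_def by blast
    then have "(\<lambda>n. g n x) \<longlonglongrightarrow> h x" by simp
    then have "(\<lambda>n. (1 / norm (g n)) * g n x) \<longlonglongrightarrow> (1 / norm h) * h x"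
      using False by (intro tendsto_mult tendsto_divide tendsto_const norms) auto
    moreover have "h x = norm h * norm x"
      using j_self[of x] norm_j[of x] by (simp add: x_def)
    then have "(1 / norm h) * h x = norm x" using False by simp
    ultimately have "(\<lambda>n. v n x) \<longlonglongrightarrow> norm x"
      by (simp add: v_def scaleR_blinfun.rep_eq)
    then have "v \<longlonglongrightarrow> u"
      by (intro smulian[OF u]) (auto simp: v_def)
    then have "(\<lambda>n. norm (g n) *\<^sub>R v n) \<longlonglongrightarrow> norm h *\<^sub>R u"
      by (intro tendsto_intros norms)
    moreover have "norm (g n) *\<^sub>R v n = g n" for n by (simp add: v_def)
    ultimately have "g \<longlonglongrightarrow> h" using hu by simp
    then show ?thesis by (simp add: LIM_zero_iff tendsto_norm_zero_iff)
  qed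
qed

lemma dual_bregman_space: "bregman_space TYPE('a \<Rightarrow>\<^sub>L real) (inverse_gauge \<phi>)"
  by unfold_locales
    (rule gauge_function_inverse[OF gauge] dual_frechet dual_strictly_convex
      reflexive_space_dual[OF reflexive] dual_radon_riesz)+

text \<open>Young's equality makes the dual potential at \<open>j x\<close> equal to
  \<open>j x x - Psi \<phi> x\<close>, and the dual duality map sends \<open>j y\<close> to
  evaluation at \<open>y\<close>. Substitution exchanges the arguments.\<close>

lemma bregman_Psi_dual:
  "bregman_Psi (inverse_gauge \<phi>) (j x) (j y) = bregman_Psi \<phi> y x"
proof -
  interpret dual: bregman_space "inverse_gauge \<phi>" "TYPE('a \<Rightarrow>\<^sub>L real)"
    by (rule dual_bregman_space)
  have "duality_map (inverse_gauge \<phi>) (j y) = bidual_eval y"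
    by (rule dual.j_eqI)
      (simp_all add: j_self norm_j norm_bidual_eval inverse_gauge_gauge[OF gauge])
  moreover have "Psi (inverse_gauge \<phi>) (j x) = j x x - Psi \<phi> x" for x
    using young_equality[OF gauge, of "norm x"] by (simp add: Psi_def norm_j j_self mult.commute)
  ultimately show ?thesis
    by (simp add: bregman_Psi_def blinfun.diff_right minus_blinfun.rep_eq)
qed

lemma right_projection_eq:
  assumes "convex (j ` K)" "closed (j ` K)" "K \<noteq> {}"
  shows "right_projection \<phi> K y = inv j (left_projection (inverse_gauge \<phi>) (j ` K) (j y))"
proof -
  interpret dual: bregman_space "inverse_gauge \<phi>" "TYPE('a \<Rightarrow>\<^sub>L real)"
    by (rule dual_bregman_space)
  let ?p = "left_projection (inverse_gauge \<phi>) (j ` K) (j y)"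
  have min_iff: "dual.is_minimizer (j ` K) (dual.j (j y)) (j x) \<longleftrightarrow>
      x \<in> K \<and> (\<forall>z\<in>K. bregman_Psi \<phi> y x \<le> bregman_Psi \<phi> y z)" for x
    by (simp add: dual.is_minimizer_iff_bregman bregman_Psi_dual
        inj_image_mem_iff[OF bij_is_inj[OF bij_j]])
  have p: "dual.is_minimizer (j ` K) (dual.j (j y)) ?p"
    using assms by (intro dual.left_projection_is_minimizer) auto
  show ?thesis
    unfolding right_projection_def min_iff[symmetric]
  proof (rule the_equality)
    show "dual.is_minimizer (j ` K) (dual.j (j y)) (j (inv j ?p))" using p by simp
    fix x assume "dual.is_minimizer (j ` K) (dual.j (j y)) (j x)"
    then have "j x = ?p" by (rule dual.minimizer_unique[OF _ p assms(1)])
    then show "x = inv j ?p" by (metis inv_j)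
  qed
qed

lemma continuous_right_projection:
  assumes "convex (j ` K)" "closed (j ` K)" "K \<noteq> {}"
  shows "continuous_on UNIV (right_projection \<phi> K)"
proof -
  interpret dual: bregman_space "inverse_gauge \<phi>" "TYPE('a \<Rightarrow>\<^sub>L real)"
    by (rule dual_bregman_space)
  have "continuous_on UNIV (left_projection (inverse_gauge \<phi>) (j ` K))"
    using assms by (intro dual.continuous_left_projection) auto
  then have "continuous_on UNIV (\<lambda>y. left_projection (inverse_gauge \<phi>) (j ` K) (j y))"
    by (rule continuous_on_compose2[OF _ continuous_j]) simp
  then have "continuous_on UNIV (\<lambda>y. inv j (left_projection (inverse_gauge \<phi>) (j ` K) (j y)))"
    by (rule continuous_on_compose2[OF continuous_inv_j]) simp
  then show ?thesis by (simp add: right_projection_eq[OF assms] cong: continuous_on_cong)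
qed

end

theorem proposition3p27:
  fixes \<phi> :: "real \<Rightarrow> real" and K :: "'a::banach set"
  assumes "gauge_function \<phi>"
    and "strictly_convex_space TYPE('a)"
    and "frechet_differentiable_space TYPE('a)"
    and "reflexive_space TYPE('a)"
    and "radon_riesz_space TYPE('a)"
    and "K \<noteq> {}"
  shows "(convex K \<and> closed K \<longrightarrow>
            continuous_on UNIV (left_projection \<phi> K) \<and>
            continuous_on UNIV (\<lambda>x. INF y\<in>K. bregman_Psi \<phi> y x)) \<and>
         (convex (duality_map \<phi> ` K) \<and> closed (duality_map \<phi> ` K) \<longrightarrow>
            continuous_on UNIV (right_projection \<phi> K))"
proof -
  interpret bregman_space \<phi> "TYPE('a)"
    by unfold_locales (rule assms)+
  show ?thesis
    using continuous_left_projection continuous_bregman_distance continuous_right_projection assms(6)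
    by blast
qed

end
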